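(* Let $0<\alpha<\tfrac12$ and $\kappa\in(\tfrac12,\infty]$. For $|z|,|w|<1$, $$\sum_{i,j\ge0}A_{ij}^{(\kappa)}z^iw^j=\frac{\ell_{\alpha,\kappa}\bigl((1-z)^{-1}\bigr)+\ell_{\alpha,\kappa}\bigl((1-w)^{-1}\bigr)}{2-z-w}.$$ In particular, the limiting matrix ($\kappa=\infty$) has the explicit generating function $$\sum_{i,j\ge0}A_{ij}^{(\infty)}z^iw^j=\Gamma(1-\alpha)\,\frac{(1-z)^{1-\alpha}+(1-w)^{1-\alpha}}{2-z-w}.$$ Thus every finite compression is given by a finite calculation.
   Context: Let $\nu(du)=e^{-u}\,du$ on $[0,\infty)$. For $\kappa\in(1/2,\infty)$ put $k_{\alpha,\kappa}(u,v)=\bigl[2\kappa\sinh(|u-v|/(2\kappa))\bigr]^{-\alpha}$, and $k_{\alpha,\infty}(u,v)=|u-v|^{-\alpha}$. For $\kappa\in(1/2,\infty]$, $S_{\alpha,\kappa}$ is the (positive, Hilbert--Schmidt) operator on $L^2(\nu)$ given by $(S_{\alpha,\kappa}h)(u)=\int_0^\infty k_{\alpha,\kappa}(u,v)h(v)\,\nu(dv)$. Let $\mathcal L_n=L_n^{(0)}$ be the standard Laguerre polynomials, an orthonormal basis of $L^2(\nu)$, and $$A_{ij}^{(\kappa)}=\langle\mathcal L_i,S_{\alpha,\kappa}\mathcal L_j\rangle_{L^2(\nu)},\qquad i,j\ge0.$$ A finite compression is an $N\times N$ principal matrix $(A_{ij}^{(\kappa)})_{0\le i,j<N}$. For $\Re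 c>0$ define $$\ell_{\alpha,\kappa}(c)=\begin{cases}\kappa^{1-\alpha}B(\kappa c+\alpha/2,1-\alpha),&\kappa<\infty,\\ \Gamma(1-\alpha)\,c^{\alpha-1},&\kappa=\infty,\end{cases}$$ where $B$ is the beta function and powers are principal branches. *)

theory Defs
  imports "HOL-Analysis.Analysis"
begin

definition nu :: "real measure" where
  "nu = density lborel (\<lambda>u. ennreal (indicator {0..} u * exp (- u)))"

(* Infinite kappa is a genuine value of the parameter, hence the type ereal.  On the
   diagonal both branches evaluate to 0 powr (- alpha) = 0 instead of infinity; the
   diagonal is a null set for the product of nu with itself, so no integral is affected. *)
definition kern :: "real \<Rightarrow> ereal \<Rightarrow> real \<Rightarrow> real \<Rightarrow> real" where
  "kern \<alpha> \<kappa> u v =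
     (if \<kappa> = \<infinity> then \<bar>u - v\<bar> powr (- \<alpha>)
      else (2 * real_of_ereal \<kappa> * sinh (\<bar>u - v\<bar> / (2 * real_of_ereal \<kappa>))) powr (- \<alpha>))"

definition S_op :: "real \<Rightarrow> ereal \<Rightarrow> (real \<Rightarrow> real) \<Rightarrow> real \<Rightarrow> real" where
  "S_op \<alpha> \<kappa> h u = (LINT v|nu. kern \<alpha> \<kappa> u v * h v)"

definition inner_nu :: "(real \<Rightarrow> real) \<Rightarrow> (real \<Rightarrow> real) \<Rightarrow> real" where
  "inner_nu f g = (LINT u|nu. f u * g u)"

definition laguerre :: "nat \<Rightarrow> real \<Rightarrow> real" where
  "laguerre n u = (\<Sum>k\<le>n. (- 1) ^ k * real (n choose k) / fact k * u ^ k)"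

definition A_mat :: "real \<Rightarrow> ereal \<Rightarrow> nat \<Rightarrow> nat \<Rightarrow> real" where
  "A_mat \<alpha> \<kappa> i j = inner_nu (laguerre i) (S_op \<alpha> \<kappa> (laguerre j))"

definition ell :: "real \<Rightarrow> ereal \<Rightarrow> complex \<Rightarrow> complex" where
  "ell \<alpha> \<kappa> c =
     (if \<kappa> = \<infinity> then complex_of_real (Gamma (1 - \<alpha>)) * c powr complex_of_real (\<alpha> - 1)
      else complex_of_real (real_of_ereal \<kappa> powr (1 - \<alpha>)) *
           Beta (complex_of_real (real_of_ereal \<kappa>) * c + complex_of_real (\<alpha> / 2))
                (complex_of_real (1 - \<alpha>)))"

(* The coefficient of z^i w^j in (a(z) + a(w)) / (2 - z - w) for a(z) = (SUM p. a p * z^p),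
   read off from 1 / (2 - z - w) = (SUM m. (z + w)^m / 2^(m+1)).  It only involves
   a 0, ..., a (max i j). *)
definition finite_entry :: "(nat \<Rightarrow> 'a::field_char_0) \<Rightarrow> nat \<Rightarrow> nat \<Rightarrow> 'a" where
  "finite_entry a i j =
     (\<Sum>p\<le>i. a p * of_nat ((i - p + j) choose j) / 2 ^ (i - p + j + 1)) +
     (\<Sum>q\<le>j. a q * of_nat ((i + (j - q)) choose i) / 2 ^ (i + (j - q) + 1))"

end

theory Submission
  imports Defs "HOL-Complex_Analysis.Complex_Analysis"
begin

text \<open>
  Write \<open>k t\<close> for the kernel at distance \<open>t\<close>, \<open>q\<^sub>n = L\<^sub>n - L\<^sub>n\<^sub>-\<^sub>1\<close> (with \<open>L\<^sub>-\<^sub>1 = 0\<close>) and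
  \<open>E\<^sub>n u = exp (- u) * q\<^sub>n u\<close>, and let \<open>F z = ell (1 / (1 - z))\<close>. The theorem says that
  \<open>(2 - z - w) * (\<Sum>i j. A\<^sub>i\<^sub>j z\<^sup>i w\<^sup>j) = F z + F w\<close>, that is,
  \<open>2 A\<^sub>i\<^sub>j - A\<^sub>i\<^sub>-\<^sub>1\<^sub>,\<^sub>j - A\<^sub>i\<^sub>,\<^sub>j\<^sub>-\<^sub>1\<close> is the \<open>i\<close>-th Taylor coefficient of \<open>F\<close> if \<open>j = 0\<close>, plus the \<open>j\<close>-th one
  if \<open>i = 0\<close>. This recursion is an integration by parts. The kernel depends on \<open>u - v\<close> only, so
  it is annihilated by the derivative along the diagonal \<open>\<partial>\<^sub>u + \<partial>\<^sub>v\<close>, while \<open>E\<^sub>n' = - exp (- u) L\<^sub>n\<close>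
  shows that this derivative turns \<open>E\<^sub>i u * E\<^sub>j v\<close> into minus the factor beside the kernel in the
  integrand of \<open>2 A\<^sub>i\<^sub>j - A\<^sub>i\<^sub>-\<^sub>1\<^sub>,\<^sub>j - A\<^sub>i\<^sub>,\<^sub>j\<^sub>-\<^sub>1\<close>. Only boundary terms survive, and \<open>E\<^sub>n 0 = 0\<close> for \<open>n > 0\<close> leaves
  the moments \<open>a\<^sub>n = \<integral> k t * E\<^sub>n t dt\<close> over the half-line.

  To make this rigorous, the quadrant is cut along the diagonal and each half is sheared to
  coordinates \<open>t = \<bar>u - v\<bar> > 0\<close> and \<open>v > 0\<close> (\<open>integral_off_diagonal\<close>); on each half the inner
  integral over \<open>v\<close> is evaluated by the fundamental theorem of calculus
  (\<open>integral_translated_product\<close>). The solution of the recursion is the finite formula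
  \<open>finite_entry\<close> applied to the moments (\<open>laguerre_matrix_eq\<close>).

  It remains to recognise the moments as the Taylor coefficients of \<open>F\<close>. By the generating
  function of the \<open>q\<^sub>n\<close> the power series with coefficients \<open>a\<^sub>n\<close> is, for small real \<open>x\<close>, the
  Laplace transform of \<open>k\<close> at \<open>1 / (1 - x)\<close> (\<open>moment_sums\<close>). For real arguments that transform is a
  Gamma or a Beta integral and equals \<open>ell\<close> (\<open>laplace_kern\<close>). Since \<open>F\<close> is holomorphic on the
  unit disc, its values on a real interval determine all its Taylor coefficients
  (\<open>power_series_coeffs_eq_of_real\<close>). Finally, each of the two summands of the double series is the
  product of the series of \<open>F\<close>, in \<open>z\<close> or in \<open>w\<close>, and the series of \<open>1 / (2 - z - w)\<close>
  (\<open>half_entry_has_sum\<close>); both factors converge absolutely on the bidisc, hence so does the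
  product.
\<close>

section \<open>Laguerre polynomials and their backward differences\<close>

text \<open>
  These are the generalised Laguerre polynomials of parameter \<open>- 1\<close>; dropping the
  term with index \<open>n - 1\<close> for \<open>n = 0\<close> amounts to \<open>L\<^sub>-\<^sub>1 = 0\<close>.
\<close>

definition laguerre_diff :: "nat \<Rightarrow> real \<Rightarrow> real" where
  "laguerre_diff n u = laguerre n u - (if n = 0 then 0 else laguerre (n - 1) u)"

lemma laguerre_diff_0 [simp]: "laguerre_diff 0 u = 1"
  by (simp add: laguerre_diff_def laguerre_def)

lemma laguerre_at_0 [simp]: "laguerre n 0 = 1"
  by (simp add: laguerre_def power_0_left if_distrib cong: if_cong)

lemma laguerre_diff_at_0: "laguerre_diff n 0 = (if n = 0 then 1 else 0)"
  by (simp add: laguerre_diff_def)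

lemma continuous_on_laguerre [continuous_intros]:
  "continuous_on A f \<Longrightarrow> continuous_on A (\<lambda>x. laguerre n (f x))"
  unfolding laguerre_def by (intro continuous_intros)

lemma continuous_on_laguerre_diff [continuous_intros]:
  "continuous_on A f \<Longrightarrow> continuous_on A (\<lambda>x. laguerre_diff n (f x))"
  unfolding laguerre_diff_def by (cases "n = 0") (auto intro!: continuous_intros)

lemma measurable_laguerre [measurable]: "laguerre n \<in> borel_measurable borel"
  unfolding laguerre_def by measurable

lemma measurable_laguerre_diff [measurable]: "laguerre_diff n \<in> borel_measurable borel"
  unfolding laguerre_diff_def by (cases "n = 0") simp_all

lemma laguerre_diff_Suc:
  "laguerre_diff (Suc n) u = (\<Sum>k\<le>n. (- 1) ^ Suc k * real (n choose k) / fact (Suc k) * u ^ Suc k)"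
proof -
  have "laguerre_diff (Suc n) u =
      (\<Sum>k\<le>Suc n. (- 1) ^ k * (real (Suc n choose k) - real (n choose k)) / fact k * u ^ k)"
    unfolding laguerre_diff_def laguerre_def
    by (simp add: sum_subtractf [symmetric] algebra_simps diff_divide_distrib)
  also have "\<dots> = (\<Sum>k\<le>n. (- 1) ^ Suc k * real (n choose k) / fact (Suc k) * u ^ Suc k)"
    by (subst sum.atMost_Suc_shift) (simp del: fact_Suc power_Suc)
  finally show ?thesis .
qed

lemma has_field_derivative_laguerre_diff_Suc:
  "(laguerre_diff (Suc n) has_field_derivative - laguerre n u) (at u within A)"
proof -
  have eq: "laguerre_diff (Suc n) =
      (\<lambda>u. \<Sum>k\<le>n. (- 1) ^ Suc k * real (n choose k) / fact (Suc k) * u ^ Suc k)"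
    by (rule ext, rule laguerre_diff_Suc)
  have "(laguerre_diff (Suc n) has_field_derivative
      (\<Sum>k\<le>n. (- 1) ^ Suc k * real (n choose k) / fact (Suc k) * (real (Suc k) * u ^ k))) (at u within A)"
    unfolding eq by (auto intro!: derivative_eq_intros simp del: fact_Suc power_Suc simp: mult_ac)
  also have "(\<Sum>k\<le>n. (- 1) ^ Suc k * real (n choose k) / fact (Suc k) * (real (Suc k) * u ^ k)) = - laguerre n u"
    unfolding laguerre_def sum_negf [symmetric]
    by (intro sum.cong refl) (simp add: fact_Suc field_simps del: of_nat_Suc)
  finally show ?thesis .
qed

text \<open>
  This is what lets the weighted matrix integrand be written as a derivative. It combines \<open>q\<^sub>n' = - L\<^sub>n\<^sub>-\<^sub>1\<close> with the definition \<open>q\<^sub>n = L\<^sub>n - L\<^sub>n\<^sub>-\<^sub>1\<close>.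
\<close>

lemma has_field_derivative_exp_laguerre_diff:
  "((\<lambda>u. exp (- u) * laguerre_diff n u) has_field_derivative - (exp (- u) * laguerre n u)) (at u within A)"
proof (cases n)
  case 0
  have "((\<lambda>u::real. exp (- u)) has_field_derivative - exp (- u)) (at u within A)"
    by (auto intro!: derivative_eq_intros)
  thus ?thesis using 0 by (simp add: laguerre_def)
next
  case (Suc m)
  have "((\<lambda>u. exp (- u) * laguerre_diff n u) has_field_derivative
      - exp (- u) * laguerre_diff n u + exp (- u) * - laguerre m u) (at u within A)"
    unfolding Suc by (auto intro!: derivative_eq_intros has_field_derivative_laguerre_diff_Suc)
  also have "- exp (- u) * laguerre_diff n u + exp (- u) * - laguerre m u = - (exp (- u) * laguerre n u)"
    using Suc by (simp add: laguerre_diff_def algebra_simps)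
  finally show ?thesis .
qed

text \<open>
  The \<open>k\<close>-th term of the exponential series of \<open>u / 2\<close> is at most the whole sum.
\<close>

lemma power_le_fact_exp:
  fixes u :: real
  assumes "0 \<le> u"
  shows "u ^ k \<le> 2 ^ k * fact k * exp (u / 2)"
proof -
  have "(u / 2) ^ k / fact k \<le> exp (u / 2)"
  proof -
    have s: "(\<lambda>n. (u/2) ^ n /\<^sub>R fact n) sums exp (u/2)" by (rule exp_converges)
    have "(\<Sum>n\<in>{k}. (u/2) ^ n /\<^sub>R fact n) \<le> (\<Sum>n. (u/2) ^ n /\<^sub>R fact n)"
      using assms by (intro sum_le_suminf sums_summable[OF s]) auto
    thus ?thesis using s by (simp add: sums_iff field_simps)
  qed
  thus ?thesis by (simp add: power_divide field_simps)
qed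

text \<open>
  Bounding each power of \<open>u\<close> leaves \<open>\<Sum>k\<le>n. (n choose k) * 2 ^ k\<close>, which is \<open>3 ^ n\<close>. The
  exponent \<open>u / 2\<close> leaves half of the weight \<open>exp (- u)\<close> for integrability, and geometric growth
  in \<open>n\<close> is enough to sum power series of radius \<open>1 / 3\<close>, which determine the coefficients.
\<close>

lemma abs_laguerre_le:
  assumes "0 \<le> u"
  shows "\<bar>laguerre n u\<bar> \<le> 3 ^ n * exp (u / 2)"
proof -
  have "\<bar>laguerre n u\<bar> \<le> (\<Sum>k\<le>n. \<bar>(- 1) ^ k * real (n choose k) / fact k * u ^ k\<bar>)"
    unfolding laguerre_def by (rule sum_abs)
  also have "\<dots> \<le> (\<Sum>k\<le>n. real (n choose k) * 2 ^ k * exp (u / 2))"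
  proof (rule sum_mono)
    fix k
    have "\<bar>(- 1) ^ k * real (n choose k) / fact k * u ^ k\<bar> = real (n choose k) / fact k * u ^ k"
      using assms by (simp add: abs_mult)
    also have "\<dots> \<le> real (n choose k) / fact k * (2 ^ k * fact k * exp (u / 2))"
      by (intro mult_left_mono power_le_fact_exp assms) auto
    also have "\<dots> = real (n choose k) * 2 ^ k * exp (u / 2)" by simp
    finally show "\<bar>(- 1) ^ k * real (n choose k) / fact k * u ^ k\<bar> \<le> real (n choose k) * 2 ^ k * exp (u / 2)" .
  qed
  also have "\<dots> = 3 ^ n * exp (u / 2)"
    using binomial_ring[of "2::real" 1 n] by (simp add: sum_distrib_right)
  finally show ?thesis .
qed

lemma abs_laguerre_diff_le:
  assumes "0 \<le> u"
  shows "\<bar>laguerre_diff n u\<bar> \<le> 2 * 3 ^ n * exp (u / 2)"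
proof (cases n)
  case 0
  have "1 \<le> exp (u / 2)" using assms by simp
  hence "1 \<le> 2 * exp (u / 2)" by linarith
  thus ?thesis using 0 by simp
next
  case (Suc m)
  have "\<bar>laguerre_diff n u\<bar> \<le> \<bar>laguerre n u\<bar> + \<bar>laguerre m u\<bar>"
    using Suc by (simp add: laguerre_diff_def)
  also have "\<dots> \<le> 3 ^ n * exp (u / 2) + 3 ^ m * exp (u / 2)"
    by (intro add_mono abs_laguerre_le assms)
  also have "\<dots> \<le> 3 ^ n * exp (u / 2) + 3 ^ n * exp (u / 2)" using Suc by simp
  finally show ?thesis by simp
qed

lemma choose_sums:
  fixes x :: real
  assumes "\<bar>x\<bar> < 1"
  shows "(\<lambda>n. real (n + k choose k) * x ^ n) sums (1 / (1 - x) ^ Suc k)"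
proof -
  have "(\<lambda>n. (- real (Suc k) gchoose n) * (- x) ^ n) sums (1 + - x) powr - real (Suc k)"
    by (rule gen_binomial_real) (use assms in auto)
  also have "(1 + - x) powr - real (Suc k) = 1 / (1 - x) ^ Suc k"
    using assms by (simp add: powr_minus powr_realpow divide_inverse del: of_nat_Suc power_Suc)
  also have "(\<lambda>n. (- real (Suc k) gchoose n) * (- x) ^ n) = (\<lambda>n. real (n + k choose k) * x ^ n)"
  proof
    fix n
    have "- real (Suc k) gchoose n = (- 1) ^ n * (real (n + k) gchoose n)"
      by (subst gbinomial_minus) (simp add: algebra_simps)
    also have "real (n + k) gchoose n = real (n + k choose k)"
      by (subst binomial_gbinomial [symmetric]) (simp add: binomial_symmetric [of n "n + k"])
    finally show "(- real (Suc k) gchoose n) * (- x) ^ n = real (n + k choose k) * x ^ n"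
      by (simp add: power_mult_distrib [symmetric])
  qed
  finally show ?thesis .
qed

lemma choose_shift_sums:
  fixes x :: real
  assumes "\<bar>x\<bar> < 1"
  shows "(\<lambda>n. real (n choose k) * x ^ n) sums (x ^ k / (1 - x) ^ Suc k)"
proof -
  have "(\<lambda>n. x ^ k * (real (n + k choose k) * x ^ n)) sums (x ^ k * (1 / (1 - x) ^ Suc k))"
    by (intro sums_mult choose_sums assms)
  hence "(\<lambda>n. real (n + k choose k) * x ^ (n + k)) sums (x ^ k / (1 - x) ^ Suc k)"
    by (simp add: power_add mult_ac)
  thus ?thesis
    by (subst (asm) sums_iff_shift) (simp add: binomial_eq_0)
qed

text \<open>
  The classical generating function. Expanding the polynomials gives a double series in \<open>n\<close> and
  the exponent \<open>k\<close> of \<open>t\<close>; summed over \<open>n\<close> first, it becomes an exponential series. The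
  restriction \<open>\<bar>x\<bar> < 1 / 3\<close> makes it absolutely convergent by the termwise bound above.
\<close>

lemma laguerre_sums:
  assumes "0 \<le> t" "\<bar>x\<bar> < 1 / 3"
  shows "(\<lambda>n. laguerre n t * x ^ n) sums (exp (- t * x / (1 - x)) / (1 - x))"
proof -
  define f where "f = (\<lambda>(n, k). (- t) ^ k / fact k * (real (n choose k) * x ^ n))"
  have "(\<lambda>p. norm (f p)) summable_on UNIV \<times> UNIV"
    unfolding Infinite_Sum.abs_summable_on_Sigma_iff
  proof (intro conjI ballI)
    have fin: "((\<lambda>k. norm (f (n, k))) has_sum (\<Sum>k\<le>n. norm (f (n, k)))) UNIV" for n
      by (rule has_sum_finite_neutralI) (auto simp: f_def binomial_eq_0)
    show "(\<lambda>k. norm (f (n, k))) summable_on UNIV" for n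
      using fin by (rule has_sum_imp_summable)
    have le: "(\<Sum>k\<le>n. norm (f (n, k))) \<le> exp (t / 2) * (3 * \<bar>x\<bar>) ^ n" for n
    proof -
      have "(\<Sum>k\<le>n. norm (f (n, k))) \<le> (\<Sum>k\<le>n. \<bar>x\<bar> ^ n * (real (n choose k) * 2 ^ k * exp (t / 2)))"
      proof (rule sum_mono)
        fix k
        have "norm (f (n, k)) = \<bar>x\<bar> ^ n * (real (n choose k) / fact k * t ^ k)"
          using assms by (simp add: f_def abs_mult power_abs)
        also have "\<dots> \<le> \<bar>x\<bar> ^ n * (real (n choose k) / fact k * (2 ^ k * fact k * exp (t / 2)))"
          by (intro mult_left_mono power_le_fact_exp assms) auto
        finally show "norm (f (n, k)) \<le> \<bar>x\<bar> ^ n * (real (n choose k) * 2 ^ k * exp (t / 2))" by simp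
      qed
      also have "\<dots> = exp (t / 2) * (3 * \<bar>x\<bar>) ^ n"
        using binomial_ring[of "2::real" 1 n]
        by (simp add: sum_distrib_right sum_distrib_left power_mult_distrib mult_ac)
      finally show ?thesis .
    qed
    show "(\<lambda>n. norm (\<Sum>\<^sub>\<infinity>k. norm (f (n, k)))) summable_on UNIV"
    proof (rule summable_on_comparison_test)
      have "summable (\<lambda>n. exp (t / 2) * (3 * \<bar>x\<bar>) ^ n)"
        using assms by (intro summable_mult summable_geometric) simp
      thus "(\<lambda>n. exp (t / 2) * (3 * \<bar>x\<bar>) ^ n) summable_on UNIV"
        by (subst summable_on_UNIV_nonneg_real_iff) auto
      show "norm (\<Sum>\<^sub>\<infinity>k. norm (f (n, k))) \<le> exp (t / 2) * (3 * \<bar>x\<bar>) ^ n" for n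
        unfolding infsumI[OF fin] using le[of n] by (simp add: sum_nonneg)
    qed auto
  qed
  hence "f summable_on UNIV \<times> UNIV" by (rule abs_summable_summable)
  then obtain S where S: "(f has_sum S) (UNIV \<times> UNIV)" by (auto simp: summable_on_def)
  have "((\<lambda>n. laguerre n t * x ^ n) has_sum S) UNIV"
  proof (rule has_sum_SigmaD[OF S])
    fix n
    show "((\<lambda>k. f (n, k)) has_sum laguerre n t * x ^ n) UNIV"
      by (rule has_sum_finite_neutralI[of "{..n}"])
         (auto simp: f_def binomial_eq_0 laguerre_def sum_distrib_right sum_distrib_left power_minus[of t] mult_ac
               intro!: sum.cong)
  qed
  hence 1: "(\<lambda>n. laguerre n t * x ^ n) sums S" by (rule has_sum_imp_sums)
  \<comment> \<open>Summing the same family over \<open>n\<close> first evaluates it in closed form.\<close>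
  have S': "((\<lambda>(k, n). f (n, k)) has_sum S) (UNIV \<times> UNIV)"
    using S by (subst has_sum_swap[symmetric]) (simp add: case_prod_unfold)
  have "((\<lambda>k. (- t) ^ k / fact k * (x ^ k / (1 - x) ^ Suc k)) has_sum S) UNIV"
  proof (rule has_sum_SigmaD[OF S'])
    fix k
    have "(\<lambda>n. f (n, k)) summable_on UNIV"
      using summable_on_SigmaD1[of "\<lambda>k n. f (n, k)" UNIV "\<lambda>_. UNIV"] has_sum_imp_summable[OF S'] by simp
    then obtain s where s: "((\<lambda>n. f (n, k)) has_sum s) UNIV" by (auto simp: summable_on_def)
    have "(\<lambda>n. f (n, k)) sums ((- t) ^ k / fact k * (x ^ k / (1 - x) ^ Suc k))"
      unfolding f_def split using assms by (intro sums_mult choose_shift_sums) auto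
    with has_sum_imp_sums[OF s] have "s = (- t) ^ k / fact k * (x ^ k / (1 - x) ^ Suc k)"
      by (rule sums_unique2)
    thus "((\<lambda>n. case (k, n) of (k, n) \<Rightarrow> f (n, k)) has_sum (- t) ^ k / fact k * (x ^ k / (1 - x) ^ Suc k)) UNIV"
      using s by simp
  qed
  hence "(\<lambda>k. (- t) ^ k / fact k * (x ^ k / (1 - x) ^ Suc k)) sums S" by (rule has_sum_imp_sums)
  also have "(\<lambda>k. (- t) ^ k / fact k * (x ^ k / (1 - x) ^ Suc k)) =
      (\<lambda>k. ((- t * x / (1 - x)) ^ k /\<^sub>R fact k) / (1 - x))"
  proof
    fix k
    have "(- t * x / (1 - x)) ^ k = (- t) ^ k * x ^ k / (1 - x) ^ k"
      by (simp only: power_divide power_mult_distrib)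
    thus "(- t) ^ k / fact k * (x ^ k / (1 - x) ^ Suc k) = ((- t * x / (1 - x)) ^ k /\<^sub>R fact k) / (1 - x)"
      by (simp add: divide_inverse mult_ac)
  qed
  finally have "S = exp (- t * x / (1 - x)) / (1 - x)"
    using sums_divide[OF exp_converges[of "- t * x / (1 - x)"], of "1 - x"] by (rule sums_unique2)
  with 1 show ?thesis by simp
qed

lemma laguerre_diff_sums:
  assumes "0 \<le> t" "\<bar>x\<bar> < 1 / 3"
  shows "(\<lambda>n. laguerre_diff n t * x ^ n) sums exp (- t * x / (1 - x))"
proof -
  let ?S = "exp (- t * x / (1 - x)) / (1 - x)"
  have L: "(\<lambda>n. laguerre n t * x ^ n) sums ?S" by (rule laguerre_sums[OF assms])
  have "(\<lambda>n. x * (laguerre n t * x ^ n)) sums (x * ?S)" by (rule sums_mult[OF L])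
  hence "(\<lambda>n. (\<lambda>n. if n = 0 then 0 else laguerre (n - 1) t * x ^ n) (Suc n)) sums (x * ?S)"
    by (simp add: mult_ac)
  hence "(\<lambda>n. if n = 0 then 0 else laguerre (n - 1) t * x ^ n) sums (x * ?S)"
    by (subst (asm) sums_Suc_iff) simp
  from sums_diff[OF L this] have "(\<lambda>n. laguerre_diff n t * x ^ n) sums (?S - x * ?S)"
    by (rule back_subst[where P = "\<lambda>f. f sums _"]) (auto simp: laguerre_diff_def fun_eq_iff algebra_simps)
  also have "?S - x * ?S = exp (- t * x / (1 - x))"
  proof -
    have "?S - x * ?S = ?S * (1 - x)" by (simp only: algebra_simps)
    thus ?thesis using assms by simp
  qed
  finally show ?thesis .
qed

section \<open>Integrals over half-lines and sheared quadrants\<close>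

lemma integrable_lborel_pair_mult:
  fixes f g :: "real \<Rightarrow> real"
  assumes "integrable lborel f" "integrable lborel g"
  shows "integrable (lborel \<Otimes>\<^sub>M lborel) (\<lambda>(x, y). f x * g y)"
proof (rule lborel_pair.Fubini_integrable)
  have [measurable]: "f \<in> borel_measurable borel" "g \<in> borel_measurable borel"
    using assms by (auto dest: borel_measurable_integrable)
  show "(\<lambda>(x, y). f x * g y) \<in> borel_measurable (lborel \<Otimes>\<^sub>M lborel)" by measurable
  show "integrable lborel (\<lambda>x. LINT y|lborel. norm (case (x, y) of (x, y) \<Rightarrow> f x * g y))"
    using assms by (simp add: abs_mult)
  show "AE x in lborel. integrable lborel (\<lambda>y. case (x, y) of (x, y) \<Rightarrow> f x * g y)"
    using assms by simp
qed

text \<open>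
  For fixed \<open>v\<close> the shear \<open>(u, v) \<mapsto> (u - v, v)\<close> is a translation, so Fubini reduces its
  invariance of Lebesgue measure to the one-dimensional case.
\<close>

lemma integrable_shear:
  fixes W :: "real \<times> real \<Rightarrow> real"
  assumes "integrable (lborel \<Otimes>\<^sub>M lborel) W"
  shows "integrable (lborel \<Otimes>\<^sub>M lborel) (\<lambda>(u, v). W (u - v, v))"
    and "integral\<^sup>L (lborel \<Otimes>\<^sub>M lborel) (\<lambda>(u, v). W (u - v, v)) = integral\<^sup>L (lborel \<Otimes>\<^sub>M lborel) W"
proof -
  have [measurable]: "W \<in> borel_measurable (borel \<Otimes>\<^sub>M borel)"
    using assms by (auto dest: borel_measurable_integrable)
  have m: "(\<lambda>(u, v). W (u - v, v)) \<in> borel_measurable (lborel \<Otimes>\<^sub>M lborel)"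
    by measurable
  have "(\<integral>\<^sup>+p. ennreal (norm (case p of (u, v) \<Rightarrow> W (u - v, v))) \<partial>(lborel \<Otimes>\<^sub>M lborel)) =
      (\<integral>\<^sup>+v. (\<integral>\<^sup>+u. ennreal (norm (W (u - v, v))) \<partial>lborel) \<partial>lborel)"
    by (subst lborel_pair.nn_integral_snd[symmetric]) (use m in auto)
  also have "\<dots> = (\<integral>\<^sup>+v. (\<integral>\<^sup>+t. ennreal (norm (W (t, v))) \<partial>lborel) \<partial>lborel)"
  proof (rule nn_integral_cong)
    fix v
    show "(\<integral>\<^sup>+u. ennreal (norm (W (u - v, v))) \<partial>lborel) = (\<integral>\<^sup>+t. ennreal (norm (W (t, v))) \<partial>lborel)"
      by (subst nn_integral_real_affine[where c = 1 and t = v]) auto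
  qed
  also have "\<dots> = (\<integral>\<^sup>+p. ennreal (norm (W p)) \<partial>(lborel \<Otimes>\<^sub>M lborel))"
    by (subst lborel_pair.nn_integral_snd[symmetric]) auto
  also have "\<dots> < \<infinity>" using assms by (simp add: integrable_iff_bounded)
  finally show int: "integrable (lborel \<Otimes>\<^sub>M lborel) (\<lambda>(u, v). W (u - v, v))"
    using m by (simp add: integrable_iff_bounded)
  have "integral\<^sup>L (lborel \<Otimes>\<^sub>M lborel) (\<lambda>(u, v). W (u - v, v)) = (LINT v|lborel. LINT u|lborel. W (u - v, v))"
    by (subst lborel_pair.integral_snd[symmetric]) (use int in auto)
  also have "\<dots> = (LINT v|lborel. LINT t|lborel. W (t, v))"
  proof (rule Bochner_Integration.integral_cong[OF refl])
    fix v
    show "(LINT u|lborel. W (u - v, v)) = (LINT t|lborel. W (t, v))"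
      by (subst lborel_integral_real_affine[where c = 1 and t = v]) auto
  qed
  also have "\<dots> = integral\<^sup>L (lborel \<Otimes>\<^sub>M lborel) W"
    using assms by (subst lborel_pair.integral_snd) (auto simp: case_prod_unfold)
  finally show "integral\<^sup>L (lborel \<Otimes>\<^sub>M lborel) (\<lambda>(u, v). W (u - v, v)) = integral\<^sup>L (lborel \<Otimes>\<^sub>M lborel) W" .
qed

lemma has_bochner_integral_lborel_of_has_integral:
  fixes f :: "real \<Rightarrow> real"
  assumes "\<And>x. x \<in> A \<Longrightarrow> 0 \<le> f x" "(f has_integral I) A"
    and m: "(\<lambda>x. indicator A x * f x) \<in> borel_measurable borel"
  shows "has_bochner_integral lborel (\<lambda>x. indicator A x * f x) I"
proof (rule has_bochner_integral_nn_integral)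
  show "0 \<le> I" using has_integral_nonneg[OF assms(2)] assms(1) by blast
  show "(\<integral>\<^sup>+x. ennreal (indicator A x * f x) \<partial>lborel) = ennreal I"
    using nn_integral_has_integral_lebesgue[OF assms(1,2)] by (simp add: ennreal_indicator ennreal_mult' flip: ennreal_mult'')
qed (use assms in \<open>auto simp: indicator_def\<close>)

lemma integrable_exp_Ioi:
  fixes c :: real assumes "c > 0"
  shows "integrable lborel (\<lambda>t. indicator {0<..} t * exp (- c * t) :: real)"
proof -
  have "((\<lambda>t. exp (- c * t)) has_integral exp (- c * 0) / c) {0<..}"
    using has_integral_exp_minus_to_infinity[OF assms, of 0] 
    by (rule has_integral_spike_set_eq[THEN iffD1, rotated 2]) (auto intro: negligible_subset[of "{0}"])
  from has_bochner_integral_lborel_of_has_integral[OF _ this]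
  show ?thesis by (auto simp: has_bochner_integral_iff)
qed

section \<open>Integration by parts along the diagonal\<close>

text \<open>
  The limiting kernel and those of finite \<open>\<kappa>\<close> differ only in the profile
  \<open>k\<close>, the kernel as a function of the distance. The value at \<open>0\<close> is normalised so that the
  quadrant integrand is exactly the sum of its two halves. The decay rate \<open>1 / 2\<close> in the last
  condition is matched to the bounds on the Laguerre polynomials.
\<close>

locale difference_kernel =
  fixes k :: "real \<Rightarrow> real"
  assumes kernel_measurable [measurable]: "k \<in> borel_measurable borel"
    and kernel_nonneg: "0 \<le> k t"
    and kernel_0: "k 0 = 0"
    and kernel_integrable: "integrable lborel (\<lambda>t. indicator {0<..} t * (k t * exp (- t / 2)))"
begin

text \<open>
  Under \<open>u = t + v\<close> this is the part of \<open>k \<bar>u - v\<bar> * f u * g v\<close> below the diagonal.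
\<close>

definition wedge :: "(real \<Rightarrow> real) \<Rightarrow> (real \<Rightarrow> real) \<Rightarrow> real \<times> real \<Rightarrow> real" where
  "wedge f g = (\<lambda>(t, v). indicator {0<..} t * indicator {0<..} v * (k t * (f (t + v) * g v)))"

definition wedge_form :: "(real \<Rightarrow> real) \<Rightarrow> (real \<Rightarrow> real) \<Rightarrow> real" where
  "wedge_form f g = integral\<^sup>L (lborel \<Otimes>\<^sub>M lborel) (wedge f g)"

definition moment :: "nat \<Rightarrow> real" where
  "moment n = (LINT t|lborel. indicator {0<..} t * (k t * (exp (- t) * laguerre_diff n t)))"

lemma integrable_wedge:
  assumes [measurable]: "f \<in> borel_measurable borel" "g \<in> borel_measurable borel"
    and f: "\<And>u. 0 \<le> u \<Longrightarrow> \<bar>f u\<bar> \<le> C * exp (- u / 2)"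
    and g: "\<And>u. 0 \<le> u \<Longrightarrow> \<bar>g u\<bar> \<le> D * exp (- u / 2)"
  shows "integrable (lborel \<Otimes>\<^sub>M lborel) (wedge f g)"
proof (rule Bochner_Integration.integrable_bound)
  show "integrable (lborel \<Otimes>\<^sub>M lborel) (\<lambda>(t, v). (C * D) * (indicator {0<..} t * (k t * exp (- t / 2))) *
      (indicator {0<..} v * exp (- 1 * v)))"
    by (intro integrable_lborel_pair_mult integrable_mult_right kernel_integrable integrable_exp_Ioi) auto
  show "wedge f g \<in> borel_measurable (lborel \<Otimes>\<^sub>M lborel)" unfolding wedge_def by measurable
  show "AE p in lborel \<Otimes>\<^sub>M lborel. norm (wedge f g p) \<le> norm (case p of (t, v) \<Rightarrow>
      (C * D) * (indicator {0<..} t * (k t * exp (- t / 2))) * (indicator {0<..} v * exp (- 1 * v)))"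
  proof (intro AE_I2, clarify)
    fix t v :: real
    show "norm (wedge f g (t, v)) \<le> norm
      ((C * D) * (indicator {0<..} t * (k t * exp (- t / 2))) * (indicator {0<..} v * exp (- 1 * v)))"
    proof (cases "t > 0 \<and> v > 0")
      case True
      have "norm (wedge f g (t, v)) = k t * (\<bar>f (t + v)\<bar> * \<bar>g v\<bar>)"
        using True kernel_nonneg[of t] by (simp add: wedge_def abs_mult)
      also have "\<dots> \<le> k t * ((C * exp (- (t + v) / 2)) * (D * exp (- v / 2)))"
        using True f[of "t + v"] g[of v]
        by (intro mult_left_mono mult_mono kernel_nonneg) (auto intro: order_trans[OF abs_ge_zero])
      also have "\<dots> = (C * D) * (k t * exp (- t / 2)) * exp (- v)"
        by (simp add: mult_ac flip: exp_add) (simp add: field_simps)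
      also have "\<dots> \<le> norm ((C * D) * (k t * exp (- t / 2)) * exp (- v))" by simp
      finally show ?thesis using True by simp
    qed (auto simp: wedge_def)
  qed
qed

end

text \<open>
  The point \<open>0\<close> is dropped in order to work with the open half-line throughout.
\<close>

lemma nu_integral:
  assumes [measurable]: "h \<in> borel_measurable borel"
  shows "(LINT u|nu. h u) = (LINT u|lborel. indicator {0<..} u * (exp (- u) * h u))"
proof -
  have "(LINT u|nu. h u) = (LINT u|lborel. (indicator {0..} u * exp (- u)) *\<^sub>R h u)"
    unfolding nu_def by (rule integral_density) auto
  also have "\<dots> = (LINT u|lborel. indicator {0<..} u * (exp (- u) * h u))"
    by (rule integral_cong_AE) (use AE_lborel_singleton[of "0::real"] in \<open>auto simp: indicator_def elim!: eventually_mono\<close>)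
  finally show ?thesis .
qed

abbreviation wlaguerre :: "nat \<Rightarrow> real \<Rightarrow> real" where
  "wlaguerre n u \<equiv> exp (- u) * laguerre n u"

abbreviation wlaguerre_diff :: "nat \<Rightarrow> real \<Rightarrow> real" where
  "wlaguerre_diff n u \<equiv> exp (- u) * laguerre_diff n u"

lemma abs_wlaguerre_le:
  assumes "0 \<le> u" shows "\<bar>wlaguerre n u\<bar> \<le> 3 ^ n * exp (- u / 2)"
proof -
  have "\<bar>wlaguerre n u\<bar> \<le> exp (- u) * (3 ^ n * exp (u / 2))"
    using abs_laguerre_le[OF assms, of n] by (simp add: abs_mult)
  also have "\<dots> = 3 ^ n * exp (- u + u / 2)" by (simp only: exp_add mult_ac)
  finally show ?thesis by simp
qed

lemma abs_wlaguerre_diff_le: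
  assumes "0 \<le> u" shows "\<bar>wlaguerre_diff n u\<bar> \<le> 2 * 3 ^ n * exp (- u / 2)"
proof -
  have "\<bar>wlaguerre_diff n u\<bar> \<le> exp (- u) * (2 * 3 ^ n * exp (u / 2))"
    using abs_laguerre_diff_le[OF assms, of n] by (simp add: abs_mult)
  also have "\<dots> = 2 * 3 ^ n * exp (- u + u / 2)" by (simp only: exp_add mult_ac)
  finally show ?thesis by simp
qed

text \<open>
  The integrand is minus the derivative in \<open>v\<close> of \<open>E\<^sub>i (t + v) * E\<^sub>j v\<close>, which vanishes at infinity.
  The value at \<open>v = 0\<close> contains \<open>E\<^sub>j 0\<close>, hence the case distinction.
\<close>

lemma integral_translated_product:
  assumes "0 \<le> t"
  shows "(LINT v|lborel. indicator {0<..} v *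
      (wlaguerre_diff i (t + v) * wlaguerre j v + wlaguerre i (t + v) * wlaguerre_diff j v)) =
      wlaguerre_diff i t * (if j = 0 then 1 else 0)"
proof -
  define f where "f v = wlaguerre_diff i (t + v) * wlaguerre j v + wlaguerre i (t + v) * wlaguerre_diff j v" for v
  define F where "F v = - (wlaguerre_diff i (t + v) * wlaguerre_diff j v)" for v
  have bound: "\<bar>a * b\<bar> \<le> C * D * exp (- 1 * v)"
    if "\<bar>a\<bar> \<le> C * exp (- (t + v) / 2)" "\<bar>b\<bar> \<le> D * exp (- v / 2)" "v \<ge> 0" "C \<ge> 0" "D \<ge> 0" for a b C D v :: real
  proof -
    have "\<bar>a * b\<bar> \<le> (C * exp (- (t + v) / 2)) * (D * exp (- v / 2))"
      unfolding abs_mult by (intro mult_mono that) (use that in auto)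
    also have "\<dots> \<le> (C * exp (- v / 2)) * (D * exp (- v / 2))"
      using assms that by (intro mult_right_mono mult_left_mono) auto
    also have "\<dots> = C * D * exp (- v / 2 + - v / 2)" by (simp only: exp_add mult_ac)
    finally show ?thesis by (simp add: field_simps)
  qed
  have der: "(F has_field_derivative f v) (at v)" for v
  proof -
    have "((\<lambda>v. wlaguerre_diff i (t + v)) has_field_derivative - wlaguerre i (t + v) * 1) (at v)"
      by (rule DERIV_chain2[OF has_field_derivative_exp_laguerre_diff]) (auto intro!: derivative_eq_intros)
    from DERIV_minus[OF DERIV_mult[OF this has_field_derivative_exp_laguerre_diff[of j v]]]
    show ?thesis unfolding F_def f_def by (simp add: algebra_simps)
  qed
  have cont: "isCont f v" for v
  proof -
    have "continuous_on UNIV f" unfolding f_def by (intro continuous_intros)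
    thus ?thesis by (simp add: continuous_on_eq_continuous_at)
  qed
  have [measurable]: "f \<in> borel_measurable borel" unfolding f_def by measurable
  have int: "integrable lborel (\<lambda>v. indicator {0<..} v * f v)"
  proof (rule Bochner_Integration.integrable_bound)
    show "integrable lborel (\<lambda>v. (2 * 3 ^ i * 3 ^ j + 3 ^ i * (2 * 3 ^ j)) * (indicator {0<..} v * exp (- 1 * v)) :: real)"
      by (intro integrable_mult_right integrable_exp_Ioi) auto
    show "AE v in lborel. norm (indicator {0<..} v * f v) \<le>
        norm ((2 * 3 ^ i * 3 ^ j + 3 ^ i * (2 * 3 ^ j)) * (indicator {0<..} v * exp (- 1 * v)) :: real)"
    proof (rule AE_I2)
      fix v :: real
      show "norm (indicator {0<..} v * f v) \<le>
        norm ((2 * 3 ^ i * 3 ^ j + 3 ^ i * (2 * 3 ^ j)) * (indicator {0<..} v * exp (- 1 * v)) :: real)"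
      proof (cases "v > 0")
        case True
        have "\<bar>f v\<bar> \<le> \<bar>wlaguerre_diff i (t + v) * wlaguerre j v\<bar> + \<bar>wlaguerre i (t + v) * wlaguerre_diff j v\<bar>"
          unfolding f_def by (rule abs_triangle_ineq)
        also have "\<dots> \<le> (2 * 3 ^ i) * 3 ^ j * exp (- 1 * v) + 3 ^ i * (2 * 3 ^ j) * exp (- 1 * v)"
          using True assms by (intro add_mono bound abs_wlaguerre_le abs_wlaguerre_diff_le) auto
        finally show ?thesis using True by (simp add: algebra_simps)
      qed auto
    qed
  qed simp
  have "(LBINT v=ereal 0..\<infinity>. f v) = 0 - F 0"
  proof (rule interval_integral_FTC_integrable[where F = F])
    show "(F has_vector_derivative f x) (at x)" for x
      using der[of x] by (simp add: has_real_derivative_iff_has_vector_derivative)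
    show "set_integrable lborel (einterval (ereal 0) \<infinity>) f"
      using int by (simp add: set_integrable_def einterval_def greaterThan_def)
    have "((F \<circ> real_of_ereal) \<longlongrightarrow> F 0) (at_right (ereal 0)) \<longleftrightarrow> (F \<longlongrightarrow> F 0) (at_right 0)"
      by (rule ereal_tendsto_simps)
    moreover have "isCont F 0" using der by (rule DERIV_isCont)
    ultimately show "((F \<circ> real_of_ereal) \<longlongrightarrow> F 0) (at_right (ereal 0))"
      by (auto simp: isCont_def intro: tendsto_mono[OF at_le])
    have "((F \<circ> real_of_ereal) \<longlongrightarrow> 0) (at_left \<infinity>) \<longleftrightarrow> (F \<longlongrightarrow> 0) at_top"
      by (rule ereal_tendsto_simps)
    moreover have "(F \<longlongrightarrow> 0) at_top"
    proof (rule Lim_null_comparison)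
      show "((\<lambda>v. (2 * 3 ^ i) * (2 * 3 ^ j) * exp (- 1 * v)) \<longlongrightarrow> (0::real)) at_top"
        by real_asymp
      show "\<forall>\<^sub>F v in at_top. norm (F v) \<le> (2 * 3 ^ i) * (2 * 3 ^ j) * exp (- 1 * v)"
        using eventually_ge_at_top[of "0::real"]
      proof eventually_elim
        case (elim v)
        show ?case unfolding F_def real_norm_def abs_minus_cancel
          using elim assms by (intro bound abs_wlaguerre_diff_le) auto
      qed
    qed
    ultimately show "((F \<circ> real_of_ereal) \<longlongrightarrow> 0) (at_left \<infinity>)" by simp
  qed (use cont in auto)
  moreover have "F 0 = - (wlaguerre_diff i t * (if j = 0 then 1 else 0))"
    by (simp add: F_def laguerre_diff_at_0)
  moreover have "(LBINT v=ereal 0..\<infinity>. f v) = (LINT v|lborel. indicator {0<..} v * f v)"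
    by (simp add: interval_lebesgue_integral_def set_lebesgue_integral_def einterval_def greaterThan_def)
  ultimately show ?thesis unfolding f_def by simp
qed

context difference_kernel
begin

text \<open>
  The two terms are the halves of the quadrant below and above the diagonal; reflection
  exchanges the roles of \<open>f\<close> and \<open>g\<close> in the second.
\<close>

lemma integral_off_diagonal:
  assumes m [measurable]: "f \<in> borel_measurable borel" "g \<in> borel_measurable borel"
    and f: "\<And>u. 0 \<le> u \<Longrightarrow> \<bar>f u\<bar> \<le> C * exp (- u / 2)"
    and g: "\<And>u. 0 \<le> u \<Longrightarrow> \<bar>g u\<bar> \<le> D * exp (- u / 2)"
  shows "(LINT u|lborel. indicator {0<..} u * (f u * (LINT v|lborel. indicator {0<..} v * (k \<bar>u - v\<bar> * g v)))) =
      wedge_form f g + wedge_form g f"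
proof -
  define H where "H = (\<lambda>(u, v). indicator {0<..} u * (f u * (indicator {0<..} v * (k \<bar>u - v\<bar> * g v))))"
  define H1 where "H1 = (\<lambda>(u, v). wedge f g (u - v, v))"
  define H2 where "H2 = (\<lambda>(u, v). wedge g f (u - v, v))"
  note wf = integrable_wedge[OF m f g] and wg = integrable_wedge[OF m(2,1) g f]
  have H1: "integrable (lborel \<Otimes>\<^sub>M lborel) H1" "integral\<^sup>L (lborel \<Otimes>\<^sub>M lborel) H1 = wedge_form f g"
    unfolding H1_def wedge_form_def using integrable_shear[OF wf] by auto
  have H2: "integrable (lborel \<Otimes>\<^sub>M lborel) H2" "integral\<^sup>L (lborel \<Otimes>\<^sub>M lborel) H2 = wedge_form g f"
    unfolding H2_def wedge_form_def using integrable_shear[OF wg] by auto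
  have H2': "integrable (lborel \<Otimes>\<^sub>M lborel) (\<lambda>(u, v). H2 (v, u))"
    "integral\<^sup>L (lborel \<Otimes>\<^sub>M lborel) (\<lambda>(u, v). H2 (v, u)) = wedge_form g f"
    using H2 lborel_pair.integrable_product_swap[OF H2(1)] lborel_pair.integral_product_swap[of H2]
    by (auto dest: borel_measurable_integrable)
  \<comment> \<open>On the diagonal both halves vanish, and so does \<open>H\<close> because \<open>k 0 = 0\<close>.\<close>
  have H: "H p = H1 p + (case p of (u, v) \<Rightarrow> H2 (v, u))" for p
    by (cases p) (auto simp: H_def H1_def H2_def wedge_def indicator_def kernel_0)
  have Hint: "integrable (lborel \<Otimes>\<^sub>M lborel) H"
    unfolding H by (intro Bochner_Integration.integrable_add H1 H2')
  have "(LINT u|lborel. indicator {0<..} u * (f u * (LINT v|lborel. indicator {0<..} v * (k \<bar>u - v\<bar> * g v)))) =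
      (LINT u|lborel. LINT v|lborel. H (u, v))"
    by (simp add: H_def)
  also have "\<dots> = integral\<^sup>L (lborel \<Otimes>\<^sub>M lborel) H"
    by (rule lborel_pair.integral_fst'[OF Hint])
  also have "\<dots> = wedge_form f g + wedge_form g f"
    unfolding H by (subst Bochner_Integration.integral_add) (use H1 H2' in auto)
  finally show ?thesis .
qed

definition laguerre_wedge :: "nat \<Rightarrow> nat \<Rightarrow> real" where
  "laguerre_wedge i j = wedge_form (wlaguerre i) (wlaguerre j)"

lemma integrable_wedge_laguerre:
  "integrable (lborel \<Otimes>\<^sub>M lborel) (wedge (wlaguerre i) (wlaguerre j))"
  "integrable (lborel \<Otimes>\<^sub>M lborel) (wedge (wlaguerre_diff i) (wlaguerre j))"
  "integrable (lborel \<Otimes>\<^sub>M lborel) (wedge (wlaguerre i) (wlaguerre_diff j))"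
  by (rule integrable_wedge[OF _ _ abs_wlaguerre_le abs_wlaguerre_le]
        integrable_wedge[OF _ _ abs_wlaguerre_diff_le abs_wlaguerre_le]
        integrable_wedge[OF _ _ abs_wlaguerre_le abs_wlaguerre_diff_le]; measurable)+

lemma wedge_form_diff_left:
  "wedge_form (wlaguerre_diff i) (wlaguerre j) =
    laguerre_wedge i j - (if i = 0 then 0 else laguerre_wedge (i - 1) j)"
proof (cases i)
  case 0
  have "wlaguerre_diff 0 = wlaguerre 0" by (auto simp: laguerre_diff_def)
  thus ?thesis using 0 by (simp add: laguerre_wedge_def)
next
  case (Suc m)
  have "wedge (wlaguerre_diff i) (wlaguerre j) =
      (\<lambda>p. wedge (wlaguerre i) (wlaguerre j) p - wedge (wlaguerre m) (wlaguerre j) p)"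
    using Suc by (auto simp: wedge_def laguerre_diff_def algebra_simps)
  thus ?thesis using Suc
    by (simp add: wedge_form_def laguerre_wedge_def integrable_wedge_laguerre)
qed

lemma wedge_form_diff_right:
  "wedge_form (wlaguerre i) (wlaguerre_diff j) =
    laguerre_wedge i j - (if j = 0 then 0 else laguerre_wedge i (j - 1))"
proof (cases j)
  case 0
  have "wlaguerre_diff 0 = wlaguerre 0" by (auto simp: laguerre_diff_def)
  thus ?thesis using 0 by (simp add: laguerre_wedge_def)
next
  case (Suc m)
  have "wedge (wlaguerre i) (wlaguerre_diff j) =
      (\<lambda>p. wedge (wlaguerre i) (wlaguerre j) p - wedge (wlaguerre i) (wlaguerre m) p)"
    using Suc by (auto simp: wedge_def laguerre_diff_def algebra_simps)
  thus ?thesis using Suc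
    by (simp add: wedge_form_def laguerre_wedge_def integrable_wedge_laguerre)
qed

text \<open>
  The integration by parts along the diagonal: the profile \<open>k t\<close> is constant in \<open>v\<close>, so only the
  boundary \<open>v = 0\<close> of the wedge contributes.
\<close>

lemma wedge_form_boundary:
  "wedge_form (wlaguerre_diff i) (wlaguerre j) + wedge_form (wlaguerre i) (wlaguerre_diff j) =
    moment i * (if j = 0 then 1 else 0)"
proof -
  let ?w = "\<lambda>p. wedge (wlaguerre_diff i) (wlaguerre j) p + wedge (wlaguerre i) (wlaguerre_diff j) p"
  have int: "integrable (lborel \<Otimes>\<^sub>M lborel) ?w"
    by (intro Bochner_Integration.integrable_add integrable_wedge_laguerre)
  have "wedge_form (wlaguerre_diff i) (wlaguerre j) + wedge_form (wlaguerre i) (wlaguerre_diff j) =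
      integral\<^sup>L (lborel \<Otimes>\<^sub>M lborel) ?w"
    by (simp add: wedge_form_def integrable_wedge_laguerre)
  also have "\<dots> = (LINT t|lborel. LINT v|lborel. ?w (t, v))"
    by (rule lborel_pair.integral_fst'[OF int, symmetric])
  also have "\<dots> = (LINT t|lborel. indicator {0<..} t * (k t * wlaguerre_diff i t) * (if j = 0 then 1 else 0))"
  proof (rule Bochner_Integration.integral_cong[OF refl])
    fix t :: real
    have "(LINT v|lborel. ?w (t, v)) = (LINT v|lborel. (indicator {0<..} t * k t) * (indicator {0<..} v *
      (wlaguerre_diff i (t + v) * wlaguerre j v + wlaguerre i (t + v) * wlaguerre_diff j v)))"
      by (rule Bochner_Integration.integral_cong[OF refl]) (simp only: wedge_def prod.case distrib_left mult_ac)
    also have "\<dots> = (indicator {0<..} t * k t) * (LINT v|lborel. (indicator {0<..} v *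
      (wlaguerre_diff i (t + v) * wlaguerre j v + wlaguerre i (t + v) * wlaguerre_diff j v)))"
      by (rule integral_mult_right_zero)
    also have "\<dots> = indicator {0<..} t * (k t * wlaguerre_diff i t) * (if j = 0 then 1 else 0)"
    proof (cases "t > 0")
      case True
      show ?thesis
        by (subst integral_translated_product) (use True in \<open>auto simp: mult_ac\<close>)
    qed simp
    finally show "(LINT v|lborel. ?w (t, v)) = \<dots>" .
  qed
  also have "\<dots> = moment i * (if j = 0 then 1 else 0)"
    unfolding moment_def by (rule integral_mult_left_zero)
  finally show ?thesis .
qed

text \<open>
  The left side of the boundary formula is \<open>2 W\<^sub>i\<^sub>j - W\<^sub>i\<^sub>-\<^sub>1\<^sub>,\<^sub>j - W\<^sub>i\<^sub>,\<^sub>j\<^sub>-\<^sub>1\<close> for \<open>W = laguerre_wedge\<close>, because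
  \<open>2 L\<^sub>i L\<^sub>j - L\<^sub>i\<^sub>-\<^sub>1 L\<^sub>j - L\<^sub>i L\<^sub>j\<^sub>-\<^sub>1 = q\<^sub>i L\<^sub>j + L\<^sub>i q\<^sub>j\<close>.
\<close>

lemma laguerre_wedge_rec:
  "2 * laguerre_wedge i j = (if i = 0 then 0 else laguerre_wedge (i - 1) j) +
     (if j = 0 then 0 else laguerre_wedge i (j - 1)) + moment i * (if j = 0 then 1 else 0)"
  using wedge_form_boundary[of i j] unfolding wedge_form_diff_left wedge_form_diff_right by argo

end

section \<open>The finite formula for the entries and its generating function\<close>

text \<open>
  The coefficient of \<open>z\<^sup>i w\<^sup>j\<close> in \<open>a(z) / (2 - z - w)\<close>. It accounts for one half of the quadrant, and
  \<open>finite_entry\<close> is its symmetrisation.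
\<close>

definition half_entry :: "(nat \<Rightarrow> 'a::field_char_0) \<Rightarrow> nat \<Rightarrow> nat \<Rightarrow> 'a" where
  "half_entry a i j = (\<Sum>p\<le>i. a p * of_nat ((i - p + j) choose j) / 2 ^ (i - p + j + 1))"

lemma finite_entry_half_entry: "finite_entry a i j = half_entry a i j + half_entry a j i"
  unfolding finite_entry_def half_entry_def by (simp add: add.commute)

text \<open>
  This is \<open>(2 - z - w) * (a(z) / (2 - z - w)) = a(z)\<close> read off coefficientwise; Pascal's rule is
  the case \<open>a(z) = 1\<close>.
\<close>

lemma half_entry_rec:
  "2 * half_entry a i j = (if i = 0 then 0 else half_entry a (i - 1) j) +
     (if j = 0 then 0 else half_entry a i (j - 1)) + a i * (if j = 0 then 1 else 0)"
proof -
  define b where "b m n = (of_nat (m + n choose n) / 2 ^ (m + n + 1) :: 'a)" for m n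
  have h: "half_entry a i j = (\<Sum>p\<le>i. a p * b (i - p) j)" for i j
    by (simp add: half_entry_def b_def)
  have b_rec: "2 * b m n = (if m = 0 then 0 else b (m - 1) n) + (if n = 0 then 0 else b m (n - 1)) +
      (if m = 0 \<and> n = 0 then 1 else 0)" for m n
  proof (cases m; cases n)
    fix m' n' assume "m = Suc m'" "n = Suc n'"
    thus ?thesis by (simp add: b_def field_simps)
  qed (auto simp: b_def)
  have "2 * half_entry a i j = (\<Sum>p\<le>i. a p * (2 * b (i - p) j))"
    by (simp add: h sum_distrib_left mult_ac)
  also have "\<dots> = (\<Sum>p\<le>i. a p * (if i - p = 0 then 0 else b (i - p - 1) j)) +
      (\<Sum>p\<le>i. a p * (if j = 0 then 0 else b (i - p) (j - 1))) +
      (\<Sum>p\<le>i. a p * (if i - p = 0 \<and> j = 0 then 1 else 0))"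
    unfolding b_rec by (simp only: distrib_left sum.distrib)
  also have "(\<Sum>p\<le>i. a p * (if i - p = 0 then 0 else b (i - p - 1) j)) =
      (if i = 0 then 0 else half_entry a (i - 1) j)"
    by (cases i) (auto simp: h intro!: sum.cong)
  also have "(\<Sum>p\<le>i. a p * (if j = 0 then 0 else b (i - p) (j - 1))) =
      (if j = 0 then 0 else half_entry a i (j - 1))"
    by (simp add: h)
  also have "(\<Sum>p\<le>i. a p * (if i - p = 0 \<and> j = 0 then 1 else 0)) = (\<Sum>p\<in>{i}. a p * (if j = 0 then 1 else 0))"
    by (rule sum.mono_neutral_cong_right) auto
  finally show ?thesis by simp
qed

lemma half_entry_unique:
  fixes a :: "nat \<Rightarrow> 'a::field_char_0"
  assumes "\<And>i j. 2 * W i j = (if i = 0 then 0 else W (i - 1) j) +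
     (if j = 0 then 0 else W i (j - 1)) + a i * (if j = 0 then 1 else 0)"
  shows "W i j = half_entry a i j"
proof (induction "i + j" arbitrary: i j rule: less_induct)
  case less
  have "(if i = 0 then 0 else W (i - 1) j) = (if i = 0 then 0 else half_entry a (i - 1) j)"
    using less by simp
  moreover have "(if j = 0 then 0 else W i (j - 1)) = (if j = 0 then 0 else half_entry a i (j - 1))"
    using less by simp
  ultimately have "2 * W i j = 2 * half_entry a i j"
    unfolding assms[of i j] half_entry_rec[of a i j] by (simp only:)
  thus ?case by simp
qed

text \<open>
  Convergence at every point of an open disc is absolute: compare with a point of larger modulus.
\<close>

lemma has_sum_of_sums_on_disc:
  fixes b :: "nat \<Rightarrow> complex"
  assumes "\<And>z. norm z < 1 \<Longrightarrow> (\<lambda>n. b n * z ^ n) sums F z" "norm z < 1"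
  shows "((\<lambda>n. b n * z ^ n) has_sum F z) UNIV"
proof -
  obtain r where r: "norm z < r" "r < 1" using dense[OF assms(2)] by auto
  have "0 \<le> r" using r(1) norm_ge_zero[of z] by linarith
  have "summable (\<lambda>n. norm (b n * z ^ n))"
    by (rule powser_insidea[where x = "complex_of_real r"])
       (use r \<open>0 \<le> r\<close> assms(1)[of "complex_of_real r"] in \<open>auto simp: sums_iff\<close>)
  thus ?thesis by (rule norm_summable_imp_has_sum) (use assms in blast)
qed

text \<open>
  Grouped by total degree \<open>n = m + j\<close> the series is \<open>\<Sum>n. (w + z) ^ n / 2 ^ (n + 1)\<close>. With absolute
  values the same grouping gives a geometric series of ratio \<open>(\<bar>z\<bar> + \<bar>w\<bar>) / 2 < 1\<close>.
\<close>

lemma binomial_kernel_has_sum: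
  fixes z w :: complex
  assumes "norm z < 1" "norm w < 1"
  shows "((\<lambda>(m, j). of_nat (m + j choose j) / 2 ^ (m + j + 1) * z ^ m * w ^ j) has_sum 1 / (2 - z - w)) UNIV"
    and "(\<lambda>(m, j). norm (of_nat (m + j choose j) / 2 ^ (m + j + 1) * z ^ m * w ^ j)) summable_on UNIV"
proof -
  define f :: "nat \<times> nat \<Rightarrow> complex" where
    "f = (\<lambda>(n, j). of_nat (n choose j) * w ^ j * z ^ (n - j) / 2 ^ (n + 1))"
  define \<sigma> where "\<sigma> = Sigma UNIV (\<lambda>n::nat. {..n})"
  have inner: "(\<Sum>j\<le>n. f (n, j)) = (1/2) * ((w + z) / 2) ^ n" for n
    by (simp add: f_def binomial_ring power_divide flip: sum_divide_distrib)
  have innern: "(\<Sum>j\<le>n. norm (f (n, j))) = (1/2) * ((norm w + norm z) / 2) ^ n" for n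
    by (simp add: f_def binomial_ring norm_mult norm_divide norm_power power_divide flip: sum_divide_distrib)
  have sn: "(\<lambda>p. norm (f p)) summable_on \<sigma>"
    unfolding Infinite_Sum.abs_summable_on_Sigma_iff \<sigma>_def
  proof (intro conjI ballI)
    show "(\<lambda>j. norm (f (n, j))) summable_on {..n}" for n by (rule summable_on_finite) auto
    have "summable (\<lambda>n. (1/2) * ((norm w + norm z) / 2) ^ n)"
      using assms by (intro summable_mult summable_geometric) auto
    hence "(\<lambda>n. (1/2) * ((norm w + norm z) / 2) ^ n) summable_on UNIV"
      by (subst summable_on_UNIV_nonneg_real_iff) auto
    thus "(\<lambda>n. norm (\<Sum>\<^sub>\<infinity>j\<in>{..n}. norm (f (n, j)))) summable_on UNIV"
      by (simp add: innern)
  qed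
  hence "f summable_on \<sigma>" by (rule abs_summable_summable)
  then obtain S where S: "(f has_sum S) \<sigma>" by (auto simp: summable_on_def)
  have "((\<lambda>n. (1/2) * ((w + z) / 2) ^ n) has_sum S) UNIV"
    by (rule has_sum_SigmaD[OF S[unfolded \<sigma>_def]]) (rule has_sum_finiteI, auto simp: inner)
  hence "(\<lambda>n. (1/2) * ((w + z) / 2) ^ n) sums S" by (rule has_sum_imp_sums)
  moreover have "(\<lambda>n. (1/2) * ((w + z) / 2) ^ n) sums ((1/2) * (1 / (1 - (w + z) / 2)))"
  proof (intro sums_mult geometric_sums)
    show "norm ((w + z) / 2) < 1"
      using norm_triangle_ineq[of w z] assms by (simp add: norm_divide)
  qed
  ultimately have "S = (1/2) * (1 / (1 - (w + z) / 2))" by (rule sums_unique2)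
  hence S': "S = 1 / (2 - z - w)"
    by (simp add: field_simps)
  have bij: "bij_betw (\<lambda>(m, j). (m + j, j)) UNIV \<sigma>"
    by (rule bij_betwI[where g = "\<lambda>(n, j). (n - j, j)"]) (auto simp: \<sigma>_def)
  have eq: "f (case p of (m, j) \<Rightarrow> (m + j, j)) =
      (case p of (m, j) \<Rightarrow> of_nat (m + j choose j) / 2 ^ (m + j + 1) * z ^ m * w ^ j)" for p
    by (cases p) (simp add: f_def mult_ac)
  show "((\<lambda>(m, j). of_nat (m + j choose j) / 2 ^ (m + j + 1) * z ^ m * w ^ j) has_sum 1 / (2 - z - w)) UNIV"
    using S unfolding S' has_sum_reindex_bij_betw[OF bij, symmetric] eq .
  show "(\<lambda>(m, j). norm (of_nat (m + j choose j) / 2 ^ (m + j + 1) * z ^ m * w ^ j)) summable_on UNIV"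
    using summable_on_reindex_bij_betw[OF bij, of "\<lambda>p. norm (f p)", THEN iffD2, OF sn] unfolding eq
    by (simp add: case_prod_unfold)
qed

text \<open>
  The Cauchy product of \<open>\<Sum>p. b\<^sub>p z\<^sup>p\<close> with the series of \<open>1 / (2 - z - w)\<close>, regrouped by
  \<open>(p, (m, j)) \<mapsto> (p + m, j)\<close>.
\<close>

lemma half_entry_has_sum:
  fixes b :: "nat \<Rightarrow> complex"
  assumes F: "\<And>z. norm z < 1 \<Longrightarrow> (\<lambda>n. b n * z ^ n) sums F z" and z: "norm z < 1" and w: "norm w < 1"
  shows "((\<lambda>(i, j). half_entry b i j * z ^ i * w ^ j) has_sum (F z / (2 - z - w))) UNIV"
proof -
  define \<beta> where "\<beta> = (\<lambda>(m, j). of_nat (m + j choose j) / 2 ^ (m + j + 1) * z ^ m * w ^ j)"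
  define f where "f = (\<lambda>(p, q). b p * z ^ p * \<beta> q)"
  have b: "((\<lambda>n. b n * z ^ n) has_sum F z) UNIV" by (rule has_sum_of_sums_on_disc[OF F z])
  hence bs: "(\<lambda>n. norm (b n * z ^ n)) summable_on UNIV"
    by (intro summable_on_iff_abs_summable_on_complex[THEN iffD1] has_sum_imp_summable)
  have \<beta>: "(\<beta> has_sum 1 / (2 - z - w)) UNIV" "(\<lambda>q. norm (\<beta> q)) summable_on UNIV"
    using binomial_kernel_has_sum[OF z w] by (simp_all add: \<beta>_def case_prod_unfold)
  have "(\<lambda>p. norm (f p)) summable_on UNIV \<times> UNIV"
    unfolding Infinite_Sum.abs_summable_on_Sigma_iff
  proof (intro conjI ballI)
    show "(\<lambda>q. norm (f (p, q))) summable_on UNIV" for p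
      unfolding f_def split norm_mult[of _ "\<beta> _"] by (intro summable_on_cmult_right \<beta>)
    have "(\<lambda>p. norm (b p * z ^ p) * (\<Sum>\<^sub>\<infinity>q. norm (\<beta> q))) summable_on UNIV"
      by (intro summable_on_cmult_left bs)
    thus "(\<lambda>p. norm (\<Sum>\<^sub>\<infinity>q. norm (f (p, q)))) summable_on UNIV"
      unfolding f_def split norm_mult[of _ "\<beta> _"]
      by (simp add: infsum_cmult_right' abs_mult infsum_nonneg)
  qed
  hence "f summable_on UNIV \<times> UNIV" by (rule abs_summable_summable)
  hence f: "(f has_sum F z / (2 - z - w)) (UNIV \<times> UNIV)"
  proof (rule has_sum_SigmaI[rotated 2])
    show "((\<lambda>q. f (p, q)) has_sum b p * z ^ p * (1 / (2 - z - w))) UNIV" for p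
      unfolding f_def split by (intro has_sum_cmult_right \<beta>)
    have "((\<lambda>p. b p * z ^ p * (1 / (2 - z - w))) has_sum F z * (1 / (2 - z - w))) UNIV"
      by (intro has_sum_cmult_left b)
    thus "((\<lambda>p. b p * z ^ p * (1 / (2 - z - w))) has_sum F z / (2 - z - w)) UNIV" by simp
  qed
  \<comment> \<open>The inner sum over \<open>{..i}\<close> collects all \<open>p\<close> contributing to the monomial \<open>z\<^sup>i w\<^sup>j\<close>.\<close>
  define \<tau> where "\<tau> = Sigma UNIV (\<lambda>(i::nat, j::nat). {..i})"
  have bij: "bij_betw (\<lambda>((i, j), p). (p, (i - p, j))) \<tau> (UNIV \<times> UNIV)"
    by (rule bij_betwI[where g = "\<lambda>(p, (m, j)). ((m + p, j), p)"]) (auto simp: \<tau>_def)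
  have g: "((\<lambda>x. f ((\<lambda>((i, j), p). (p, (i - p, j))) x)) has_sum F z / (2 - z - w)) \<tau>"
    by (rule has_sum_reindex_bij_betw[OF bij, of f, THEN iffD2, OF f])
  show ?thesis
  proof (rule has_sum_SigmaD[OF g[unfolded \<tau>_def]])
    fix q :: "nat \<times> nat"
    obtain i j where q: "q = (i, j)" by (cases q)
    have "(\<Sum>p\<le>i. f (p, (i - p, j))) = half_entry b i j * z ^ i * w ^ j"
      unfolding half_entry_def sum_distrib_right
    proof (intro sum.cong refl)
      fix p assume "p \<in> {..i}"
      hence "z ^ i = z ^ p * z ^ (i - p)" by (simp flip: power_add)
      thus "f (p, (i - p, j)) = b p * of_nat ((i - p + j) choose j) / 2 ^ (i - p + j + 1) * z ^ i * w ^ j"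
        by (simp add: f_def \<beta>_def mult_ac)
    qed
    thus "((\<lambda>p. f ((\<lambda>((i, j), p). (p, (i - p, j))) (q, p))) has_sum
        (case q of (i, j) \<Rightarrow> half_entry b i j * z ^ i * w ^ j)) (case q of (i, j) \<Rightarrow> {..i})"
      by (simp add: q has_sum_finiteI)
  qed
qed

lemma finite_entry_has_sum:
  fixes b :: "nat \<Rightarrow> complex"
  assumes F: "\<And>z. norm z < 1 \<Longrightarrow> (\<lambda>n. b n * z ^ n) sums F z" and z: "norm z < 1" and w: "norm w < 1"
  shows "((\<lambda>(i, j). finite_entry b i j * z ^ i * w ^ j) has_sum ((F z + F w) / (2 - z - w))) UNIV"
proof -
  have "((\<lambda>(j, i). half_entry b j i * w ^ j * z ^ i) has_sum (F w / (2 - z - w))) (UNIV \<times> UNIV)"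
    using half_entry_has_sum[OF F w z] by (simp add: algebra_simps)
  hence "((\<lambda>(i, j). half_entry b j i * w ^ j * z ^ i) has_sum (F w / (2 - z - w))) (UNIV \<times> UNIV)"
    by (subst has_sum_swap) (simp add: case_prod_unfold)
  hence "((\<lambda>(i, j). half_entry b j i * w ^ j * z ^ i) has_sum (F w / (2 - z - w))) UNIV" by simp
  from has_sum_add[OF half_entry_has_sum[OF F z w] this]
  have "((\<lambda>p. (case p of (i, j) \<Rightarrow> half_entry b i j * z ^ i * w ^ j) +
      (case p of (i, j) \<Rightarrow> half_entry b j i * w ^ j * z ^ i)) has_sum (F z + F w) / (2 - z - w)) UNIV"
    by (simp add: add_divide_distrib)
  also have "(\<lambda>p. (case p of (i, j) \<Rightarrow> half_entry b i j * z ^ i * w ^ j) +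
      (case p of (i, j) \<Rightarrow> half_entry b j i * w ^ j * z ^ i)) = (\<lambda>(i, j). finite_entry b i j * z ^ i * w ^ j)"
    by (auto simp: fun_eq_iff finite_entry_half_entry algebra_simps)
  finally show ?thesis .
qed

section \<open>The matrix entries and the power series of the moments\<close>

context difference_kernel
begin

lemma laguerre_matrix_eq:
  "(LINT u|nu. laguerre i u * (LINT v|nu. k \<bar>u - v\<bar> * laguerre j v)) = finite_entry moment i j"
proof -
  have inner: "(LINT v|nu. k \<bar>u - v\<bar> * laguerre j v) =
      (LINT v|lborel. indicator {0<..} v * (k \<bar>u - v\<bar> * wlaguerre j v))" for u
    by (subst nu_integral) (auto simp: mult_ac)
  have "(LINT u|nu. laguerre i u * (LINT v|nu. k \<bar>u - v\<bar> * laguerre j v)) =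
     (LINT u|lborel. indicator {0<..} u * (wlaguerre i u *
        (LINT v|lborel. indicator {0<..} v * (k \<bar>u - v\<bar> * wlaguerre j v))))"
    unfolding inner by (subst nu_integral) (auto simp: mult_ac)
  also have "\<dots> = laguerre_wedge i j + laguerre_wedge j i"
    unfolding laguerre_wedge_def
    by (rule integral_off_diagonal[OF _ _ abs_wlaguerre_le abs_wlaguerre_le]) auto
  also have "laguerre_wedge = half_entry moment"
    by (intro ext half_entry_unique laguerre_wedge_rec)
  finally show ?thesis by (simp add: finite_entry_half_entry)
qed

text \<open>
  Multiplying the generating function of the differences by \<open>exp (- t)\<close> gives
  \<open>exp (- t / (1 - x))\<close>. Sum and integral commute because the \<open>n\<close>-th term is dominated by
  \<open>2 * (3 * \<bar>x\<bar>) ^ n * k t * exp (- t / 2)\<close>.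
\<close>

lemma moment_sums:
  assumes x: "\<bar>x\<bar> < 1 / 3"
  shows "(\<lambda>n. moment n * x ^ n) sums (LINT t|lborel. indicator {0<..} t * (k t * exp (- (1 / (1 - x) * t))))"
proof -
  define f where "f n t = indicator {0<..} t * (k t * wlaguerre_diff n t) * x ^ n" for n t
  define K where "K = (LINT t|lborel. indicator {0<..} t * (k t * exp (- t / 2)))"
  have bound: "norm (f n t) \<le> 2 * (3 * \<bar>x\<bar>) ^ n * (indicator {0<..} t * (k t * exp (- t / 2)))" for n t
  proof (cases "t > 0")
    case True
    have "norm (f n t) = (k t * \<bar>wlaguerre_diff n t\<bar>) * \<bar>x\<bar> ^ n"
      using True kernel_nonneg[of t] by (simp add: f_def abs_mult power_abs)
    also have "\<dots> \<le> (k t * (2 * 3 ^ n * exp (- t / 2))) * \<bar>x\<bar> ^ n"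
      using True by (intro mult_right_mono mult_left_mono abs_wlaguerre_diff_le kernel_nonneg) auto
    finally show ?thesis using True by (simp add: power_mult_distrib mult_ac)
  qed (auto simp: f_def)
  have bint: "integrable lborel (\<lambda>t. 2 * (3 * \<bar>x\<bar>) ^ n * (indicator {0<..} t * (k t * exp (- t / 2))))" for n
    by (intro integrable_mult_right kernel_integrable)
  have int: "integrable lborel (f n)" for n
  proof (rule Bochner_Integration.integrable_bound[OF bint])
    show "f n \<in> borel_measurable lborel" unfolding f_def by measurable
    show "AE t in lborel. norm (f n t) \<le> norm (2 * (3 * \<bar>x\<bar>) ^ n * (indicator {0<..} t * (k t * exp (- t / 2))))"
      using order_trans[OF bound abs_ge_self] by (intro AE_I2) (simp only: real_norm_def)
  qed
  have sums: "(\<lambda>n. f n t) sums (indicator {0<..} t * (k t * exp (- (1 / (1 - x) * t))))" for t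
  proof (cases "t > 0")
    case True
    have "(\<lambda>n. k t * exp (- t) * (laguerre_diff n t * x ^ n)) sums (k t * exp (- t) * exp (- t * x / (1 - x)))"
      using True x by (intro sums_mult laguerre_diff_sums) auto
    also have "k t * exp (- t) * exp (- t * x / (1 - x)) = k t * exp (- t + - t * x / (1 - x))"
      by (simp only: exp_add mult_ac)
    also have "- t + - t * x / (1 - x) = - (1 / (1 - x) * t)"
      using x by (simp add: divide_simps) (simp add: algebra_simps)
    finally show ?thesis using True by (simp add: f_def mult_ac)
  qed (auto simp: f_def)
  have geo: "summable (\<lambda>n. 2 * (3 * \<bar>x\<bar>) ^ n * c)" for c :: real
    using x by (intro summable_mult summable_mult2 summable_geometric) auto
  have "(\<lambda>n. integral\<^sup>L lborel (f n)) sums (LINT t|lborel. (\<Sum>n. f n t))"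
  proof (rule sums_integral[OF int])
    show "AE t in lborel. summable (\<lambda>n. norm (f n t))"
      by (intro AE_I2 summable_comparison_test'[OF geo]) (use bound in auto)
    show "summable (\<lambda>n. LINT t|lborel. norm (f n t))"
    proof (rule summable_comparison_test'[OF geo[of K]])
      fix n
      have "(LINT t|lborel. norm (f n t)) \<le>
          (LINT t|lborel. 2 * (3 * \<bar>x\<bar>) ^ n * (indicator {0<..} t * (k t * exp (- t / 2))))"
        by (intro integral_mono integrable_norm int bint bound)
      also have "\<dots> = 2 * (3 * \<bar>x\<bar>) ^ n * K"
        unfolding K_def by (rule integral_mult_right_zero)
      finally show "norm (LINT t|lborel. norm (f n t)) \<le> 2 * (3 * \<bar>x\<bar>) ^ n * K" by simp
    qed
  qed
  also have "(\<lambda>n. integral\<^sup>L lborel (f n)) = (\<lambda>n. moment n * x ^ n)"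
    unfolding f_def moment_def by (intro ext integral_mult_left_zero)
  also have "(LINT t|lborel. (\<Sum>n. f n t)) =
      (LINT t|lborel. indicator {0<..} t * (k t * exp (- (1 / (1 - x) * t))))"
    using sums by (simp add: sums_iff)
  finally show ?thesis .
qed

end

text \<open>
  If the coefficients differed, the difference of the two series would have no zeros in some
  punctured neighbourhood of \<open>0\<close>, yet it vanishes on a real interval.
\<close>

lemma power_series_coeffs_eq_of_real:
  fixes b :: "nat \<Rightarrow> complex" and a :: "nat \<Rightarrow> real"
  assumes r: "0 < r"
    and b: "\<And>z. norm z < r \<Longrightarrow> (\<lambda>n. b n * z ^ n) sums F z"
    and a: "\<And>x. \<bar>x\<bar> < r \<Longrightarrow> (\<lambda>n. a n * x ^ n) sums G x"
    and eq: "\<And>x. \<bar>x\<bar> < r \<Longrightarrow> F (of_real x) = of_real (G x)"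
  shows "b n = of_real (a n)"
proof (rule ccontr)
  define d where "d n = b n - of_real (a n)" for n
  define f where "f z = (\<Sum>n. d n * z ^ n)" for z
  assume "b n \<noteq> of_real (a n)"
  hence dn: "d n \<noteq> 0" by (simp add: d_def)
  have dx: "(\<lambda>n. d n * of_real x ^ n) sums 0" if "\<bar>x\<bar> < r" for x
    using sums_diff[OF b[of "of_real x"] sums_of_real[OF a[OF that], where 'a = complex]] that eq[OF that]
    by (simp add: d_def algebra_simps)
  have f: "(\<lambda>n. d n * z ^ n) sums f z" if z: "norm z < r" for z
  proof -
    obtain x where x: "norm z < x" "x < r" using dense[OF z] by auto
    have "summable (\<lambda>n. d n * of_real x ^ n)"
      using dx[of x] x norm_ge_zero[of z] by (auto simp: sums_iff)
    hence "summable (\<lambda>n. d n * z ^ n)"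
      by (rule powser_inside) (use x norm_ge_zero[of z] in auto)
    thus ?thesis by (simp add: f_def summable_sums)
  qed
  have fx: "f (of_real x) = 0" if "\<bar>x\<bar> < r" for x
    using sums_unique2[OF f dx[OF that]] that by simp
  have "(\<lambda>n. d n * 0 ^ n) sums d 0" by (rule powser_sums_zero)
  hence "d 0 = 0" using sums_unique2[OF _ dx[of 0]] r by simp
  hence "n > 0" using dn by (cases n) auto
  have "f 0 = 0" using fx[of 0] r by simp
  obtain s where s: "0 < s" "\<And>z. z \<in> cball 0 s - {0} \<Longrightarrow> f z \<noteq> 0"
    by (rule powser_0_nonzero[of r 0 d f n]) (use r f \<open>f 0 = 0\<close> dn \<open>n > 0\<close> in auto)
  define x where "x = min s (r / 2)"
  have "f (of_real x) \<noteq> 0" using s r by (intro s(2)) (auto simp: x_def)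
  moreover have "f (of_real x) = 0" using s r by (intro fx) (auto simp: x_def)
  ultimately show False by contradiction
qed

section \<open>Laplace transforms of the kernels\<close>

lemma has_integral_change_of_variables_nonneg:
  fixes f g :: "real \<Rightarrow> real"
  assumes "S \<in> sets lebesgue" "\<And>x. x \<in> S \<Longrightarrow> (g has_field_derivative g' x) (at x within S)"
    and "inj_on g S" "\<And>y. y \<in> g ` S \<Longrightarrow> 0 \<le> f y" "(f has_integral b) (g ` S)"
  shows "((\<lambda>x. \<bar>g' x\<bar> * f (g x)) has_integral b) S"
proof -
  have "f absolutely_integrable_on g ` S" "integral (g ` S) f = b"
    using assms(4,5) by (auto intro!: nonnegative_absolutely_integrable_1)
  hence "(\<lambda>x. \<bar>g' x\<bar> * f (g x)) absolutely_integrable_on S \<and> integral S (\<lambda>x. \<bar>g' x\<bar> * f (g x)) = b"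
    by (subst has_absolute_integral_change_of_variables_1'[OF assms(1-3)]) auto
  thus ?thesis by (auto simp: has_integral_iff absolutely_integrable_on_def)
qed

lemma laplace_powr:
  fixes c \<alpha> :: real
  assumes c: "c > 0" and \<alpha>: "\<alpha> < 1"
  shows "((\<lambda>t. t powr (- \<alpha>) * exp (- (c * t))) has_integral Gamma (1 - \<alpha>) * c powr (\<alpha> - 1)) {0<..}"
proof -
  have im: "(\<lambda>t. c * t) ` {0<..} = {0<..}"
    using c by (auto intro!: image_eqI[where x = "_ / c"])
  have "((\<lambda>t. t powr (1 - \<alpha> - 1) / exp t) has_integral Gamma (1 - \<alpha>)) {0..}"
    by (rule Gamma_integral_real) (use \<alpha> in simp)
  hence "((\<lambda>t. t powr (1 - \<alpha> - 1) / exp t) has_integral Gamma (1 - \<alpha>)) ((\<lambda>t. c * t) ` {0<..})"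
    unfolding im
    by (rule has_integral_spike_set_eq[THEN iffD1, rotated 2]) (auto intro: negligible_subset[of "{0}"])
  hence "((\<lambda>t. \<bar>c\<bar> * ((c * t) powr (1 - \<alpha> - 1) / exp (c * t))) has_integral Gamma (1 - \<alpha>)) {0<..}"
    by (intro has_integral_change_of_variables_nonneg)
       (use c in \<open>auto intro!: derivative_eq_intros inj_onI\<close>)
  from has_integral_mult_right[OF this, of "c powr (\<alpha> - 1)"]
  have "((\<lambda>t. c powr (\<alpha> - 1) * (\<bar>c\<bar> * ((c * t) powr (1 - \<alpha> - 1) / exp (c * t)))) has_integral
      c powr (\<alpha> - 1) * Gamma (1 - \<alpha>)) {0<..}" .
  moreover have "c powr (\<alpha> - 1) * (\<bar>c\<bar> * ((c * t) powr (1 - \<alpha> - 1) / exp (c * t))) =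
      t powr (- \<alpha>) * exp (- (c * t))" if "t \<in> {0<..}" for t
  proof -
    have "c powr (\<alpha> - 1) * c * c powr (- \<alpha>) = c powr (\<alpha> - 1) * c powr 1 * c powr (- \<alpha>)"
      using c by simp
    also have "\<dots> = c powr (\<alpha> - 1 + 1 + - \<alpha>)" by (simp only: powr_add)
    also have "\<dots> = 1" using c by simp
    finally have "c powr (\<alpha> - 1) * c * c powr (- \<alpha>) = 1" .
    hence "(c powr (\<alpha> - 1) * c * c powr (- \<alpha>)) * (t powr (- \<alpha>) * exp (- (c * t))) = t powr (- \<alpha>) * exp (- (c * t))"
      by simp
    thus ?thesis using that c by (simp add: powr_mult exp_minus divide_inverse mult_ac)
  qed
  ultimately show ?thesis
    by (subst (asm) has_integral_cong) (auto simp: mult_ac)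
qed

text \<open>
  With \<open>x = exp (- t / \<kappa>)\<close> one has \<open>2 * \<kappa> * sinh (t / (2 * \<kappa>)) = \<kappa> * x powr (- 1 / 2) * (1 - x)\<close>
  and \<open>exp (- (c * t)) = x powr (\<kappa> * c)\<close>, which produces the Beta integral.
\<close>

lemma laplace_sinh_powr:
  fixes c \<alpha> \<kappa> :: real
  assumes c: "c > 0" and \<alpha>: "0 < \<alpha>" "\<alpha> < 1" and \<kappa>: "\<kappa> > 0"
  shows "((\<lambda>t. (2 * \<kappa> * sinh (t / (2 * \<kappa>))) powr (- \<alpha>) * exp (- (c * t))) has_integral
      \<kappa> powr (1 - \<alpha>) * Beta (\<kappa> * c + \<alpha> / 2) (1 - \<alpha>)) {0<..}"
proof -
  define a where "a = \<kappa> * c + \<alpha> / 2"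
  have a: "a > 0" using assms by (simp add: a_def add_pos_pos)
  have im: "(\<lambda>t. exp (- t / \<kappa>)) ` {0<..} = {0<..<1}"
  proof (intro equalityI subsetI)
    fix y :: real assume "y \<in> {0<..<1}"
    thus "y \<in> (\<lambda>t. exp (- t / \<kappa>)) ` {0<..}"
      using \<kappa> by (intro image_eqI[where x = "- \<kappa> * ln y"]) (auto simp: mult_less_0_iff)
  qed (use \<kappa> in auto)
  have "((\<lambda>t. t powr (a - 1) * (1 - t) powr (1 - \<alpha> - 1)) has_integral Beta a (1 - \<alpha>)) {0..1}"
    by (rule has_integral_Beta_real) (use a \<alpha> in auto)
  hence "((\<lambda>t. t powr (a - 1) * (1 - t) powr (1 - \<alpha> - 1)) has_integral Beta a (1 - \<alpha>))
      ((\<lambda>t. exp (- t / \<kappa>)) ` {0<..})"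
    unfolding im by (simp add: has_integral_Icc_iff_Ioo)
  hence "((\<lambda>t. \<bar>- exp (- t / \<kappa>) / \<kappa>\<bar> * (exp (- t / \<kappa>) powr (a - 1) * (1 - exp (- t / \<kappa>)) powr (1 - \<alpha> - 1)))
      has_integral Beta a (1 - \<alpha>)) {0<..}"
    by (intro has_integral_change_of_variables_nonneg)
       (use \<kappa> in \<open>auto intro!: derivative_eq_intros inj_onI\<close>)
  from has_integral_mult_right[OF this, of "\<kappa> powr (1 - \<alpha>)"]
  have "((\<lambda>t. \<kappa> powr (1 - \<alpha>) * (\<bar>- exp (- t / \<kappa>) / \<kappa>\<bar> *
      (exp (- t / \<kappa>) powr (a - 1) * (1 - exp (- t / \<kappa>)) powr (1 - \<alpha> - 1)))) has_integral
      \<kappa> powr (1 - \<alpha>) * Beta a (1 - \<alpha>)) {0<..}" .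
  moreover have "\<kappa> powr (1 - \<alpha>) * (\<bar>- exp (- t / \<kappa>) / \<kappa>\<bar> *
      (exp (- t / \<kappa>) powr (a - 1) * (1 - exp (- t / \<kappa>)) powr (1 - \<alpha> - 1))) =
      (2 * \<kappa> * sinh (t / (2 * \<kappa>))) powr (- \<alpha>) * exp (- (c * t))" if "t \<in> {0<..}" for t
  proof -
    define e where "e = 1 - exp (- t / \<kappa>)"
    have e: "e > 0" using that \<kappa> by (simp add: e_def)
    have "exp (t / (2 * \<kappa>)) * exp (- t / \<kappa>) = exp (- (t / (2 * \<kappa>)))"
      using \<kappa> by (simp flip: exp_add)
    hence "exp (t / (2 * \<kappa>)) * e = exp (t / (2 * \<kappa>)) - exp (- (t / (2 * \<kappa>)))"
      by (simp only: e_def right_diff_distrib mult_1_right)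
    hence "2 * \<kappa> * sinh (t / (2 * \<kappa>)) = \<kappa> * (exp (t / (2 * \<kappa>)) * e)"
      by (simp add: sinh_field_def)
    hence "(2 * \<kappa> * sinh (t / (2 * \<kappa>))) powr (- \<alpha>) = \<kappa> powr (- \<alpha>) * (exp (- \<alpha> * (t / (2 * \<kappa>))) * e powr (- \<alpha>))"
      using e \<kappa> by (simp add: powr_mult exp_powr_real mult_ac)
    hence 1: "(2 * \<kappa> * sinh (t / (2 * \<kappa>))) powr (- \<alpha>) * exp (- (c * t)) =
        \<kappa> powr (- \<alpha>) * e powr (- \<alpha>) * exp (- \<alpha> * (t / (2 * \<kappa>)) + - (c * t))"
      by (simp only: exp_add mult_ac)
    have "exp (- t / \<kappa>) * exp (- t / \<kappa>) powr (a - 1) = exp (- t / \<kappa> + (- t / \<kappa>) * (a - 1))"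
      by (simp only: exp_powr_real exp_add)
    also have "- t / \<kappa> + (- t / \<kappa>) * (a - 1) = - \<alpha> * (t / (2 * \<kappa>)) + - (c * t)"
      using \<kappa> by (simp add: a_def field_simps)
    finally have 2: "exp (- t / \<kappa>) * exp (- t / \<kappa>) powr (a - 1) = exp (- \<alpha> * (t / (2 * \<kappa>)) + - (c * t))" .
    have 3: "\<kappa> powr (- \<alpha>) = \<kappa> powr (1 - \<alpha>) / \<kappa>"
      using \<kappa> powr_diff[of \<kappa> "1 - \<alpha>" 1] by simp
    have "\<kappa> powr (1 - \<alpha>) * (\<bar>- exp (- t / \<kappa>) / \<kappa>\<bar> * (exp (- t / \<kappa>) powr (a - 1) * e powr (1 - \<alpha> - 1))) =
        \<kappa> powr (- \<alpha>) * e powr (- \<alpha>) * (exp (- t / \<kappa>) * exp (- t / \<kappa>) powr (a - 1))"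
      unfolding 3 using \<kappa> by simp
    thus ?thesis unfolding 1 2 e_def .
  qed
  ultimately show ?thesis
    by (subst (asm) has_integral_cong) (auto simp: a_def)
qed

lemma kern_eq: "kern \<alpha> \<kappa> u v = kern \<alpha> \<kappa> \<bar>u - v\<bar> 0"
  by (simp add: kern_def)

lemma measurable_kern: "(\<lambda>t. kern \<alpha> \<kappa> t 0) \<in> borel_measurable borel"
  unfolding kern_def sinh_field_def by (cases "\<kappa> = \<infinity>") simp_all

text \<open>
  Real arguments suffice to identify Taylor coefficients, and here \<open>ell\<close> takes real values.
\<close>

lemma laplace_kern:
  fixes \<alpha> c :: real
  assumes \<alpha>: "0 < \<alpha>" "\<alpha> < 1" and \<kappa>: "0 < \<kappa>" and c: "0 < c"
  shows "\<exists>I. ell \<alpha> \<kappa> (of_real c) = of_real I \<and>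
    has_bochner_integral lborel (\<lambda>t. indicator {0<..} t * (kern \<alpha> \<kappa> t 0 * exp (- (c * t)))) I"
proof -
  have "\<exists>I. ell \<alpha> \<kappa> (of_real c) = of_real I \<and>
      ((\<lambda>t. kern \<alpha> \<kappa> t 0 * exp (- (c * t))) has_integral I) {0<..}"
  proof (cases "\<kappa> = \<infinity>")
    case True
    have "ell \<alpha> \<kappa> (of_real c) = of_real (Gamma (1 - \<alpha>) * c powr (\<alpha> - 1))"
      using True c powr_of_real[of c "\<alpha> - 1"] by (simp add: ell_def)
    moreover have "((\<lambda>t. kern \<alpha> \<kappa> t 0 * exp (- (c * t))) has_integral Gamma (1 - \<alpha>) * c powr (\<alpha> - 1)) {0<..}"
      using laplace_powr[OF c \<alpha>(2)] True by (subst has_integral_cong) (auto simp: kern_def)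
    ultimately show ?thesis by blast
  next
    case False
    then obtain r where r: "\<kappa> = ereal r" "r > 0" using \<kappa> by (cases \<kappa>) auto
    have "ell \<alpha> \<kappa> (of_real c) = of_real (r powr (1 - \<alpha>) * Beta (r * c + \<alpha> / 2) (1 - \<alpha>))"
      using r Beta_complex_of_real[of "r * c + \<alpha> / 2" "1 - \<alpha>"] by (simp add: ell_def)
    moreover have "((\<lambda>t. kern \<alpha> \<kappa> t 0 * exp (- (c * t))) has_integral
        r powr (1 - \<alpha>) * Beta (r * c + \<alpha> / 2) (1 - \<alpha>)) {0<..}"
      using laplace_sinh_powr[OF c \<alpha> r(2)] r by (subst has_integral_cong) (auto simp: kern_def)
    ultimately show ?thesis by blast
  qed
  then obtain I where I: "ell \<alpha> \<kappa> (of_real c) = of_real I"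
    "((\<lambda>t. kern \<alpha> \<kappa> t 0 * exp (- (c * t))) has_integral I) {0<..}" by blast
  have [measurable]: "(\<lambda>t. kern \<alpha> \<kappa> t 0) \<in> borel_measurable borel" by (rule measurable_kern)
  have "has_bochner_integral lborel (\<lambda>t. indicator {0<..} t * (kern \<alpha> \<kappa> t 0 * exp (- (c * t)))) I"
  proof (rule has_bochner_integral_lborel_of_has_integral[OF _ I(2)])
    show "0 \<le> kern \<alpha> \<kappa> t 0 * exp (- (c * t))" for t by (simp add: kern_def)
  qed measurable
  with I(1) show ?thesis by blast
qed

lemma difference_kernel_kern:
  assumes \<alpha>: "0 < \<alpha>" "\<alpha> < 1" and \<kappa>: "0 < \<kappa>"
  shows "difference_kernel (\<lambda>t. kern \<alpha> \<kappa> t 0)"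
proof
  show "integrable lborel (\<lambda>t. indicator {0<..} t * (kern \<alpha> \<kappa> t 0 * exp (- t / 2)))"
    using laplace_kern[OF assms, of "1/2"] by (auto simp: has_bochner_integral_iff)
qed (use measurable_kern in \<open>auto simp: kern_def\<close>)

section \<open>Generating function of the matrix\<close>

lemma Re_inverse_one_minus_pos:
  fixes z :: complex
  assumes "norm z < 1"
  shows "Re (inverse (1 - z)) > 0"
proof -
  have "Re z < 1" using complex_Re_le_cmod[of z] assms by linarith
  thus ?thesis by (simp add: complex_inverse Re_divide' add_pos_nonneg divide_pos_pos)
qed

lemma holomorphic_ell:
  assumes \<alpha>: "0 < \<alpha>" "\<alpha> < 1" and \<kappa>: "0 < \<kappa>"
  shows "(\<lambda>z. ell \<alpha> \<kappa> (inverse (1 - z))) holomorphic_on ball 0 1"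
proof (cases "\<kappa> = \<infinity>")
  case True
  have "inverse (1 - z) \<notin> \<real>\<^sub>\<le>\<^sub>0" if "z \<in> ball 0 1" for z :: complex
    using Re_inverse_one_minus_pos[of z] that by (auto simp: complex_nonpos_Reals_iff)
  thus ?thesis using True unfolding ell_def by (auto intro!: holomorphic_intros)
next
  case False
  then obtain r where r: "\<kappa> = ereal r" "r > 0" using \<kappa> by (cases \<kappa>) auto
  have "complex_of_real r * inverse (1 - z) + of_real (\<alpha> / 2) \<notin> \<int>\<^sub>\<le>\<^sub>0" if "z \<in> ball 0 1" for z :: complex
  proof
    assume "complex_of_real r * inverse (1 - z) + of_real (\<alpha> / 2) \<in> \<int>\<^sub>\<le>\<^sub>0"
    then obtain n where n: "complex_of_real r * inverse (1 - z) + of_real (\<alpha> / 2) = of_int n" "n \<le> 0"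
      by (rule nonpos_Ints_cases)
    have "0 < r * Re (inverse (1 - z)) + \<alpha> / 2"
      using Re_inverse_one_minus_pos[of z] that r \<alpha> by (intro add_pos_pos mult_pos_pos) auto
    also have "\<dots> = Re (complex_of_real r * inverse (1 - z) + of_real (\<alpha> / 2))" by simp
    also have "\<dots> \<le> 0" unfolding n(1) using n(2) by simp
    finally show False by simp
  qed
  moreover have "complex_of_real (1 - \<alpha>) \<notin> \<int>\<^sub>\<le>\<^sub>0"
    using \<alpha> by (auto elim!: nonpos_Ints_cases simp: complex_eq_iff)
  ultimately show ?thesis using r unfolding ell_def by (auto intro!: holomorphic_intros)
qed

text \<open>
  The sequence \<open>b\<close> is left open so that the same statement covers Taylor coefficients given by
  iterated derivatives and the binomial coefficients of the limiting case.
\<close>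

lemma A_mat_eq_finite_entry:
  assumes \<alpha>: "0 < \<alpha>" "\<alpha> < 1" and \<kappa>: "0 < \<kappa>"
    and b: "\<And>z :: complex. norm z < 1 \<Longrightarrow> (\<lambda>n. b n * z ^ n) sums ell \<alpha> \<kappa> (inverse (1 - z))"
  shows "complex_of_real (A_mat \<alpha> \<kappa> i j) = finite_entry b i j"
proof -
  interpret difference_kernel "\<lambda>t. kern \<alpha> \<kappa> t 0"
    by (rule difference_kernel_kern[OF \<alpha> \<kappa>])
  have "b n = of_real (moment n)" for n
  proof (rule power_series_coeffs_eq_of_real)
    show "(\<lambda>n. b n * z ^ n) sums ell \<alpha> \<kappa> (inverse (1 - z))" if "norm z < 1 / 3" for z :: complex
      using that by (intro b) auto
    show "(\<lambda>n. moment n * x ^ n) sums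
        (LINT t|lborel. indicator {0<..} t * (kern \<alpha> \<kappa> t 0 * exp (- (1 / (1 - x) * t))))" if "\<bar>x\<bar> < 1 / 3" for x
      by (rule moment_sums[OF that])
    show "ell \<alpha> \<kappa> (inverse (1 - of_real x)) = of_real
        (LINT t|lborel. indicator {0<..} t * (kern \<alpha> \<kappa> t 0 * exp (- (1 / (1 - x) * t))))" if "\<bar>x\<bar> < 1 / 3" for x
    proof -
      have eq: "inverse (1 - complex_of_real x) = of_real (1 / (1 - x))" by (simp add: inverse_eq_divide)
      show ?thesis unfolding eq using laplace_kern[OF \<alpha> \<kappa>, of "1 / (1 - x)"] that
        by (auto simp: has_bochner_integral_iff)
    qed
  qed simp
  hence b_eq: "b = (\<lambda>n. of_real (moment n))" by blast
  have "A_mat \<alpha> \<kappa> i j = (LINT u|nu. laguerre i u * (LINT v|nu. kern \<alpha> \<kappa> \<bar>u - v\<bar> 0 * laguerre j v))"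
    unfolding A_mat_def inner_nu_def S_op_def by (subst kern_eq) (rule refl)
  also have "\<dots> = finite_entry moment i j"
    by (rule laguerre_matrix_eq)
  finally show ?thesis by (simp add: b_eq finite_entry_def)
qed

lemma ell_infinity:
  fixes z :: complex
  assumes "norm z < 1"
  shows "ell \<alpha> \<infinity> (inverse (1 - z)) = of_real (Gamma (1 - \<alpha>)) * (1 - z) powr of_real (1 - \<alpha>)"
proof -
  have "Re z < 1" using complex_Re_le_cmod[of z] assms by linarith
  hence "1 - z \<notin> \<real>\<^sub>\<le>\<^sub>0" "z \<noteq> 1" by (auto simp: complex_nonpos_Reals_iff)
  thus ?thesis by (simp add: ell_def powr_def Ln_inverse algebra_simps)
qed

theorem proposition6p2:
  fixes \<alpha> :: real and \<kappa> :: ereal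
  assumes "0 < \<alpha>" and "\<alpha> < 1 / 2" and "ereal (1 / 2) < \<kappa>"
  shows
    "(\<forall>z w :: complex. norm z < 1 \<longrightarrow> norm w < 1 \<longrightarrow>
        ((\<lambda>(i, j). complex_of_real (A_mat \<alpha> \<kappa> i j) * z ^ i * w ^ j) has_sum
          ((ell \<alpha> \<kappa> (inverse (1 - z)) + ell \<alpha> \<kappa> (inverse (1 - w))) / (2 - z - w))) UNIV)
   \<and> (\<forall>z w :: complex. norm z < 1 \<longrightarrow> norm w < 1 \<longrightarrow>
        ((\<lambda>(i, j). complex_of_real (A_mat \<alpha> \<infinity> i j) * z ^ i * w ^ j) has_sum
          (complex_of_real (Gamma (1 - \<alpha>)) *
            (((1 - z) powr complex_of_real (1 - \<alpha>) + (1 - w) powr complex_of_real (1 - \<alpha>))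
              / (2 - z - w)))) UNIV)
   \<and> (\<forall>N. \<forall>i<N. \<forall>j<N.
        complex_of_real (A_mat \<alpha> \<kappa> i j) =
          finite_entry (\<lambda>p. (deriv ^^ p) (\<lambda>z. ell \<alpha> \<kappa> (inverse (1 - z))) 0 / fact p) i j
      \<and> A_mat \<alpha> \<infinity> i j =
          finite_entry (\<lambda>p. Gamma (1 - \<alpha>) * ((- 1) ^ p * ((1 - \<alpha>) gchoose p))) i j)"
proof -
  have \<alpha>: "0 < \<alpha>" "\<alpha> < 1" using assms by auto
  have \<kappa>: "0 < \<kappa>" using assms(3) by (rule less_trans[rotated]) (simp add: zero_ereal_def)
  define b where "b p = (deriv ^^ p) (\<lambda>z. ell \<alpha> \<kappa> (inverse (1 - z))) 0 / fact p" for p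
  define a where "a p = Gamma (1 - \<alpha>) * ((- 1) ^ p * ((1 - \<alpha>) gchoose p))" for p
  have b: "(\<lambda>n. b n * z ^ n) sums ell \<alpha> \<kappa> (inverse (1 - z))" if "norm z < 1" for z :: complex
    using holomorphic_power_series[OF holomorphic_ell[OF \<alpha> \<kappa>], of z] that by (simp add: b_def)
  have a: "(\<lambda>n. of_real (a n) * z ^ n) sums ell \<alpha> \<infinity> (inverse (1 - z))" if "norm z < 1" for z :: complex
  proof -
    have "(\<lambda>n. (of_real (1 - \<alpha>) gchoose n) * (- z) ^ n) sums (1 + - z) powr of_real (1 - \<alpha>)"
      by (rule gen_binomial_complex) (use that in simp)
    moreover have "(of_real (1 - \<alpha>) gchoose n :: complex) = of_real ((1 - \<alpha>) gchoose n)" for n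
      by (simp add: gbinomial_prod_rev)
    ultimately have "(\<lambda>n. of_real ((1 - \<alpha>) gchoose n) * (- z) ^ n) sums (1 - z) powr of_real (1 - \<alpha>)"
      by (simp only: diff_conv_add_uminus)
    from sums_mult[OF this, of "of_real (Gamma (1 - \<alpha>))"]
    show ?thesis unfolding ell_infinity[OF that] a_def by (simp add: power_minus[of z] mult_ac)
  qed
  have Ab: "complex_of_real (A_mat \<alpha> \<kappa> i j) = finite_entry b i j" for i j
    by (rule A_mat_eq_finite_entry[OF \<alpha> \<kappa> b])
  have Aa: "complex_of_real (A_mat \<alpha> \<infinity> i j) = finite_entry (\<lambda>n. of_real (a n)) i j" for i j
    by (rule A_mat_eq_finite_entry[OF \<alpha> _ a]) auto
  have "complex_of_real (A_mat \<alpha> \<infinity> i j) = of_real (finite_entry a i j)" for i j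
    unfolding Aa by (simp add: finite_entry_def)
  hence Aa': "A_mat \<alpha> \<infinity> i j = finite_entry a i j" for i j
    by (simp only: of_real_eq_iff)
  have "((\<lambda>(i, j). complex_of_real (A_mat \<alpha> \<kappa> i j) * z ^ i * w ^ j) has_sum
          ((ell \<alpha> \<kappa> (inverse (1 - z)) + ell \<alpha> \<kappa> (inverse (1 - w))) / (2 - z - w))) UNIV"
    if "norm z < 1" "norm w < 1" for z w :: complex
    unfolding Ab by (rule finite_entry_has_sum[OF b that])
  moreover have "((\<lambda>(i, j). complex_of_real (A_mat \<alpha> \<infinity> i j) * z ^ i * w ^ j) has_sum
          (complex_of_real (Gamma (1 - \<alpha>)) *
            (((1 - z) powr complex_of_real (1 - \<alpha>) + (1 - w) powr complex_of_real (1 - \<alpha>))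
              / (2 - z - w)))) UNIV"
    if "norm z < 1" "norm w < 1" for z w :: complex
    using finite_entry_has_sum[OF a that]
    unfolding Aa ell_infinity[OF that(1)] ell_infinity[OF that(2)]
    by (simp only: distrib_left times_divide_eq_right)
  ultimately show ?thesis
    using Ab Aa' unfolding b_def a_def by blast
qed

end
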